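(* Let $(W,S)$ be a universal Coxeter system of (finite) rank $m\geq 3$. (a) For each integer $n\geq 1$ there is an RGD-system $\mathcal{D}_n$ of type $(W,S)$ with $\mathrm{ndeg}(\mathcal{D}_n)=n$. (b) There exists an RGD-system $\mathcal{D}$ of type $(W,S)$ with $\mathrm{ndeg}(\mathcal{D})=\infty$.
   Context: A Coxeter system $(W,S)$ is universal if $st$ has infinite order for all $s\neq t\in S$; its rank is $|S|$. **Roots.** Let $\ell$ be the length function. For $s\in S$ put $\alpha_s=\{w\in W\mid \ell(sw)>\ell(w)\}$. A root is a subset $v\alpha_s\subseteq W$ ($v\in W$, $s\in S$); $\Phi$ is the set of roots, $W$ acts on it by left multiplication, $-\alpha=W\setminus\alpha$, $\Phi_+=\{\alpha\in\Phi\mid 1_W\in\alpha\}$. A pair $\{\alpha,\beta\}$ of roots is prenilpotent if $\alpha\cap\beta\neq\emptyset\neq(-\alpha)\cap(-\beta)$; then $[\alpha,\beta]=\{\gamma\in\Phi\mid\alpha\cap\beta\subseteq\gamma,\ (-\alpha)\cap(-\beta)\subseteq-\gamma\}$ and $(\alpha,\beta)=[\alpha,\beta]\setminus\{\alpha,\beta\}$. **RGD-systems.** An RGD-system of type $(W,S)$ is a pair $\mathcal{D}=(G,(U_\alpha)_{\alpha\in\Phi})$ of a group and subgroups (root groups) such that, with $H=\bigcap_{\alpha\in\Phi}N_G(U_\alpha)$ and $U_+=\langle U_\alpha\mid\alpha\in\Phi_+\rangle$: (RGD0) all $U_\alpha\neq\{1\}$; (RGD1) $[U_\alpha,U_\beta]\leq\langle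 U_\gamma\mid\gamma\in(\alpha,\beta)\rangle$ for every prenilpotent pair $\{\alpha,\beta\}$, $\alpha\neq\beta$; (RGD2) for each $s\in S$, $u\in U_{\alpha_s}\setminus\{1\}$ there are $u',u''\in U_{-\alpha_s}$ such that $u'uu''$ conjugates $U_\beta$ onto $U_{s\beta}$ for each $\beta\in\Phi$; (RGD3) $U_{-\alpha_s}\not\leq U_+$ for each $s\in S$; (RGD4) $G=H\langle U_\alpha\mid\alpha\in\Phi\rangle$. For $w\in W$ let $U_w=\langle U_\alpha\mid w\notin\alpha\in\Phi_+\rangle$ (nilpotent whenever the root groups are nilpotent). $\mathrm{ndeg}(\mathcal{D})\in\mathbb{N}\cup\{\infty\}$ is the supremum of the nilpotency classes of the (nilpotent) subgroups $U_w$ over all $w\in W$. *)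

theory Defs
  imports "HOL-Algebra.Algebra" "HOL-Library.Extended_Nat"
begin

section \<open>Nilpotency class\<close>

definition commutator_subgroup :: "('a, 'b) monoid_scheme \<Rightarrow> 'a set \<Rightarrow> 'a set \<Rightarrow> 'a set" where
  "commutator_subgroup G A B =
     generate G (\<Union>a\<in>A. \<Union>b\<in>B. {a \<otimes>\<^bsub>G\<^esub> b \<otimes>\<^bsub>G\<^esub> inv\<^bsub>G\<^esub> a \<otimes>\<^bsub>G\<^esub> inv\<^bsub>G\<^esub> b})"

text \<open>The indexing starts at \<open>0\<close>, so that a group has class at most \<open>c\<close> iff term number \<open>c\<close> of
  the series is trivial.\<close>

primrec lower_central :: "('a, 'b) monoid_scheme \<Rightarrow> nat \<Rightarrow> 'a set" where
  "lower_central G 0 = carrier G"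
| "lower_central G (Suc n) = commutator_subgroup G (lower_central G n) (carrier G)"

definition nilpotent_group :: "('a, 'b) monoid_scheme \<Rightarrow> bool" where
  "nilpotent_group G \<longleftrightarrow> group G \<and> (\<exists>n. lower_central G n = {\<one>\<^bsub>G\<^esub>})"

text \<open>For a group that is not nilpotent this is \<open>Inf {} = \<infinity>\<close>.\<close>

definition nilpotency_class :: "('a, 'b) monoid_scheme \<Rightarrow> enat" where
  "nilpotency_class G = Inf {enat n | n. lower_central G n = {\<one>\<^bsub>G\<^esub>}}"


section \<open>Coxeter systems\<close>

text \<open>The relators are \<open>(st)\<close> to the power \<open>ord (st)\<close> for \<open>s, t \<in> S\<close>. The library's \<open>ord\<close> is \<open>0\<close> for
  elements of infinite order, which then contribute only the trivial relator \<open>[]\<close>. When the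
  elements of \<open>S\<close> are involutions, \<open>s = t\<close> gives the relator \<open>[s, s]\<close>. Every generator is therefore
  its own inverse modulo this congruence, and presenting \<open>W\<close> as a monoid by it is the same as
  presenting \<open>W\<close> as a group by the relators.\<close>

inductive coxeter_cong :: "('w, 'b) monoid_scheme \<Rightarrow> 'w set \<Rightarrow> 'w list \<Rightarrow> 'w list \<Rightarrow> bool"
  for W and S where
  refl: "coxeter_cong W S u u"
| sym: "coxeter_cong W S u v \<Longrightarrow> coxeter_cong W S v u"
| trans: "coxeter_cong W S u v \<Longrightarrow> coxeter_cong W S v w \<Longrightarrow> coxeter_cong W S u w"
| append: "coxeter_cong W S u v \<Longrightarrow> coxeter_cong W S x y \<Longrightarrow> coxeter_cong W S (u @ x) (v @ y)"
| relator: "s \<in> S \<Longrightarrow> t \<in> S \<Longrightarrow>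
    coxeter_cong W S (concat (replicate (group.ord W (s \<otimes>\<^bsub>W\<^esub> t)) [s, t])) []"

definition word_prod :: "('w, 'b) monoid_scheme \<Rightarrow> 'w list \<Rightarrow> 'w" where
  "word_prod W ws = foldr (\<otimes>\<^bsub>W\<^esub>) ws \<one>\<^bsub>W\<^esub>"

locale coxeter_system = group W for W (structure) +
  fixes S :: "'a set"
  assumes gens_subset: "S \<subseteq> carrier W"
    and gens_ord: "s \<in> S \<Longrightarrow> ord s = 2"
    and gens_generate: "generate W S = carrier W"
    and presentation: "us \<in> lists S \<Longrightarrow> vs \<in> lists S \<Longrightarrow>
          word_prod W us = word_prod W vs \<longleftrightarrow> coxeter_cong W S us vs"

locale universal_coxeter_system = coxeter_system +
  assumes ord_infinite: "s \<in> S \<Longrightarrow> t \<in> S \<Longrightarrow> s \<noteq> t \<Longrightarrow> ord (s \<otimes> t) = 0"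

definition cox_length :: "('w, 'b) monoid_scheme \<Rightarrow> 'w set \<Rightarrow> 'w \<Rightarrow> nat" where
  "cox_length W S w = (LEAST n. \<exists>ws \<in> lists S. length ws = n \<and> word_prod W ws = w)"


section \<open>Roots\<close>

definition simple_root :: "('w, 'b) monoid_scheme \<Rightarrow> 'w set \<Rightarrow> 'w \<Rightarrow> 'w set" where
  "simple_root W S s = {w \<in> carrier W. cox_length W S (s \<otimes>\<^bsub>W\<^esub> w) > cox_length W S w}"

definition roots :: "('w, 'b) monoid_scheme \<Rightarrow> 'w set \<Rightarrow> 'w set set" where
  "roots W S = {v <#\<^bsub>W\<^esub> simple_root W S s | v s. v \<in> carrier W \<and> s \<in> S}"

definition neg_root :: "('w, 'b) monoid_scheme \<Rightarrow> 'w set \<Rightarrow> 'w set" where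
  "neg_root W \<alpha> = carrier W - \<alpha>"

definition pos_roots :: "('w, 'b) monoid_scheme \<Rightarrow> 'w set \<Rightarrow> 'w set set" where
  "pos_roots W S = {\<alpha> \<in> roots W S. \<one>\<^bsub>W\<^esub> \<in> \<alpha>}"

definition prenilpotent :: "('w, 'b) monoid_scheme \<Rightarrow> 'w set \<Rightarrow> 'w set \<Rightarrow> bool" where
  "prenilpotent W \<alpha> \<beta> \<longleftrightarrow> \<alpha> \<inter> \<beta> \<noteq> {} \<and> neg_root W \<alpha> \<inter> neg_root W \<beta> \<noteq> {}"

definition closed_root_interval ::
    "('w, 'b) monoid_scheme \<Rightarrow> 'w set \<Rightarrow> 'w set \<Rightarrow> 'w set \<Rightarrow> 'w set set" where
  "closed_root_interval W S \<alpha> \<beta> =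
     {\<gamma> \<in> roots W S. \<alpha> \<inter> \<beta> \<subseteq> \<gamma> \<and> neg_root W \<alpha> \<inter> neg_root W \<beta> \<subseteq> neg_root W \<gamma>}"

definition open_root_interval ::
    "('w, 'b) monoid_scheme \<Rightarrow> 'w set \<Rightarrow> 'w set \<Rightarrow> 'w set \<Rightarrow> 'w set set" where
  "open_root_interval W S \<alpha> \<beta> = closed_root_interval W S \<alpha> \<beta> - {\<alpha>, \<beta>}"


section \<open>RGD-systems\<close>

text \<open>A family of root groups is a function on all subsets of \<open>W\<close>. Only its values on roots are used.\<close>

definition root_normalizer ::
    "('w, 'b) monoid_scheme \<Rightarrow> 'w set \<Rightarrow> ('g, 'c) monoid_scheme \<Rightarrow> ('w set \<Rightarrow> 'g set) \<Rightarrow> 'g set" where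
  "root_normalizer W S G U = {g \<in> carrier G. \<forall>\<alpha> \<in> roots W S. g \<in> normalizer G (U \<alpha>)}"

definition pos_subgroup ::
    "('w, 'b) monoid_scheme \<Rightarrow> 'w set \<Rightarrow> ('g, 'c) monoid_scheme \<Rightarrow> ('w set \<Rightarrow> 'g set) \<Rightarrow> 'g set" where
  "pos_subgroup W S G U = generate G (\<Union>\<alpha> \<in> pos_roots W S. U \<alpha>)"

locale RGD_system = coxeter_system W S + G: group G
  for W (structure) and S and G (structure) +
  fixes U :: "'a set \<Rightarrow> 'c set"
  assumes root_subgroup: "\<alpha> \<in> roots W S \<Longrightarrow> subgroup (U \<alpha>) G"
    and RGD0: "\<alpha> \<in> roots W S \<Longrightarrow> U \<alpha> \<noteq> {\<one>\<^bsub>G\<^esub>}"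
    and RGD1: "\<alpha> \<in> roots W S \<Longrightarrow> \<beta> \<in> roots W S \<Longrightarrow> \<alpha> \<noteq> \<beta> \<Longrightarrow> prenilpotent W \<alpha> \<beta> \<Longrightarrow>
      commutator_subgroup G (U \<alpha>) (U \<beta>) \<subseteq> generate G (\<Union>\<gamma> \<in> open_root_interval W S \<alpha> \<beta>. U \<gamma>)"
    and RGD2: "s \<in> S \<Longrightarrow> u \<in> U (simple_root W S s) - {\<one>\<^bsub>G\<^esub>} \<Longrightarrow>
      \<exists>u' \<in> U (neg_root W (simple_root W S s)). \<exists>u'' \<in> U (neg_root W (simple_root W S s)).
        \<forall>\<beta> \<in> roots W S.
          (u' \<otimes>\<^bsub>G\<^esub> u \<otimes>\<^bsub>G\<^esub> u'') <#\<^bsub>G\<^esub> U \<beta> #>\<^bsub>G\<^esub> inv\<^bsub>G\<^esub> (u' \<otimes>\<^bsub>G\<^esub> u \<otimes>\<^bsub>G\<^esub> u'') = U (s <#\<^bsub>W\<^esub> \<beta>)"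
    and RGD3: "s \<in> S \<Longrightarrow> \<not> U (neg_root W (simple_root W S s)) \<subseteq> pos_subgroup W S G U"
    and RGD4: "carrier G = root_normalizer W S G U <#>\<^bsub>G\<^esub> generate G (\<Union>\<alpha> \<in> roots W S. U \<alpha>)"

definition U_sub ::
    "('w, 'b) monoid_scheme \<Rightarrow> 'w set \<Rightarrow> ('g, 'c) monoid_scheme \<Rightarrow> ('w set \<Rightarrow> 'g set) \<Rightarrow> 'w \<Rightarrow> 'g set" where
  "U_sub W S G U w = generate G (\<Union>\<alpha> \<in> {\<alpha> \<in> pos_roots W S. w \<notin> \<alpha>}. U \<alpha>)"

text \<open>The degree \<open>ndeg\<close> is meaningful only if all groups \<open>U\<^sub>w\<close> are nilpotent. Otherwise the
  definition below yields \<open>\<infinity>\<close> for a different reason, so nilpotency has to be required separately.\<close>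

definition nilpotent_RGD ::
    "('w, 'b) monoid_scheme \<Rightarrow> 'w set \<Rightarrow> ('g, 'c) monoid_scheme \<Rightarrow> ('w set \<Rightarrow> 'g set) \<Rightarrow> bool" where
  "nilpotent_RGD W S G U \<longleftrightarrow>
     (\<forall>w \<in> carrier W. nilpotent_group (G\<lparr>carrier := U_sub W S G U w\<rparr>))"

definition ndeg ::
    "('w, 'b) monoid_scheme \<Rightarrow> 'w set \<Rightarrow> ('g, 'c) monoid_scheme \<Rightarrow> ('w set \<Rightarrow> 'g set) \<Rightarrow> enat" where
  "ndeg W S G U = (SUP w \<in> carrier W. nilpotency_class (G\<lparr>carrier := U_sub W S G U w\<rparr>))"

end

theory Submission
  imports Defs "HOL-Library.Sublist"
begin

text \<open>The Cayley graph of \<open>W\<close> is a tree, roots are half-trees, that is, directed edges, and a pair of roots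
  is prenilpotent iff the roots are nested. Take all root groups of order two and
  \<open>\<langle>n\<^sub>s, u\<^sub>s\<rangle> \<cong> S\<^sub>3\<close> for each \<open>s\<close>. Then \<open>G\<close> is a quotient of the free product of these groups,
  \<open>s \<mapsto> n\<^sub>s\<close> extends to \<open>W\<close>, and a \<open>W\<close>-equivariant family of commutator relations along words must be
  chosen. Fix distinct \<open>a, b, c \<in> S\<close>. All root elements along a path commute, except that the root
  element of an edge \<open>a\<close> followed by \<open>(b a)\<^sup>k b (c b)\<^sup>i c\<close> has with that of the last edge a commutator equal to
  the root element of the last edge of the path with \<open>i\<close> replaced by \<open>i\<close> with bit \<open>k\<close> cleared, provided this bit
  is set and \<open>k \<in> L\<close>. A commutator lowers the number of set bits in \<open>L\<close>, so the class of \<open>U\<^sub>w\<close> is at most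
  \<open>card L + 1\<close>, and it is attained by long paths; \<open>L = {..<n - 1}\<close> and \<open>L = UNIV\<close> give the two parts.

  The relations do not collapse: let \<open>U\<^sub>+\<close> be the group presented by the relations between positive roots.
  For each \<open>s\<close> the action of \<open>U\<^sub>+\<close> on itself by left multiplication extends to an action of
  \<open>\<langle>n\<^sub>s, U\<^sub>+\<rangle>\<close>, and \<open>G\<close> is the permutation group generated by all these actions on the set \<open>U\<^sub>+\<close>. In it,
  \<open>n\<^sub>s u\<^sub>s n\<^sub>s\<close> is not a left multiplication, which is (RGD3).\<close>

section \<open>Relations along words\<close>

text \<open>The group \<open>S\<^sub>3\<close> generated by two involutions \<open>n\<close> and \<open>u\<close> with \<open>(nu)\<^sup>3 = 1\<close>: each constructor
  spells out a product, \<open>G1\<close> being the identity. Right multiplication by \<open>u\<close> and \<open>n\<close> is \<open>rmu\<close>, \<open>rmn\<close>,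
  left multiplication is \<open>lmu\<close>, \<open>lmn\<close>.\<close>

datatype s3 = G1 | GU | GN | GUN | GNU | GUNU

fun rmu :: "s3 \<Rightarrow> s3" where
  "rmu G1 = GU" | "rmu GU = G1" | "rmu GN = GNU" | "rmu GNU = GN" | "rmu GUN = GUNU" | "rmu GUNU = GUN"

fun rmn :: "s3 \<Rightarrow> s3" where
  "rmn G1 = GN" | "rmn GN = G1" | "rmn GU = GUN" | "rmn GUN = GU" | "rmn GNU = GUNU" | "rmn GUNU = GNU"

fun lmu :: "s3 \<Rightarrow> s3" where
  "lmu G1 = GU" | "lmu GU = G1" | "lmu GN = GUN" | "lmu GUN = GN" | "lmu GNU = GUNU" | "lmu GUNU = GNU"

fun lmn :: "s3 \<Rightarrow> s3" where
  "lmn G1 = GN" | "lmn GN = G1" | "lmn GU = GNU" | "lmn GNU = GU" | "lmn GUN = GUNU" | "lmn GUNU = GUN"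

text \<open>The sign character of \<open>S_3\<close>, with kernel the rotations \<open>1\<close>,
  \<open>un\<close>, \<open>nu\<close>. Its values distinguish the two cosets among which
  \<open>transduce\<close> decides at the end of a word.\<close>

fun s3_odd :: "s3 \<Rightarrow> bool" where
  "s3_odd G1 = False" | "s3_odd GU = True" | "s3_odd GN = True"
| "s3_odd GUN = False" | "s3_odd GNU = False" | "s3_odd GUNU = True"

lemma s3_simps [simp]:
  "rmu (rmu h) = h" "rmn (rmn h) = h" "lmu (lmu h) = h" "lmn (lmn h) = h"
  "s3_odd (rmu h) = (\<not> s3_odd h)" "s3_odd (lmu h) = (\<not> s3_odd h)" "s3_odd (lmn h) = (\<not> s3_odd h)"
  "lmu (rmu h) = rmu (lmu h)" "lmu (rmn h) = rmn (lmu h)" "lmn (rmu h) = rmu (lmn h)" "lmn (rmn h) = rmn (lmn h)"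
  by (cases h; simp)+

locale blueprint =
  fixes S :: "'a set" and a b c :: 'a and L :: "nat set"
  assumes abc: "a \<in> S" "b \<in> S" "c \<in> S" "a \<noteq> b" "a \<noteq> c" "b \<noteq> c"
begin

section \<open>The words \<open>(b a)^k b (c b)^i c\<close> and the clearing of bits of
  \<open>i\<close>\<close>

definition tail :: "nat \<Rightarrow> 'a list" where
  "tail i = concat (replicate i [c, b]) @ [c]"

primrec block :: "nat \<Rightarrow> nat \<Rightarrow> 'a list" where
  "block 0 i = b # tail i"
| "block (Suc k) i = b # a # block k i"

lemma tail_Suc: "tail (Suc i) = c # b # tail i" and tail_0: "tail 0 = [c]"
  by (simp_all add: tail_def)

lemma set_tail: "set (tail i) \<subseteq> {b, c}"
  by (induction i) (auto simp: tail_Suc tail_0)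

lemma tail_inj: "tail i = tail j \<Longrightarrow> i = j"
  by (drule arg_cong[of _ _ length]) (simp add: tail_def length_concat sum_list_replicate)

lemma hd_tail: "\<exists>x. tail i = c # x"
  by (cases i) (auto simp: tail_Suc tail_0)

lemma block_ne [simp]: "block k i \<noteq> []" and last_block [simp]: "last (block k i) = c"
proof -
  have "tail i \<noteq> [] \<and> last (tail i) = c" for i by (simp add: tail_def)
  then have "block k i \<noteq> [] \<and> last (block k i) = c" by (induction k) auto
  then show "block k i \<noteq> []" "last (block k i) = c" by auto
qed

lemma Nil_neq_block [simp]: "[] \<noteq> block k i"
  by (metis block_ne)

lemma block_inj: "block k i = block k' i' \<Longrightarrow> k = k' \<and> i = i'"
proof (induction k arbitrary: k')
  case 0
  then show ?case using hd_tail[of i] tail_inj abc by (cases k') auto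
next
  case (Suc k)
  then show ?case using hd_tail[of i'] abc by (cases k') auto
qed

text \<open>In \<open>(b a)^k b (c b)^i c\<close> the letter \<open>a\<close> occurs only in the
  first factor, so what follows an \<open>a\<close> is a block with smaller \<open>k\<close> and the
  same \<open>i\<close>. The clause for all \<open>i'\<close> allows bits of the index to be changed
  while the part before stays fixed.\<close>

lemma block_split:
  assumes "x @ [a] @ y = block k i"
  obtains k' where "k' < k" "y = block k' i" "\<And>i'. x @ [a] @ block k' i' = block k i'"
proof -
  have "\<exists>k'<k. y = block k' i \<and> (\<forall>i'. x @ [a] @ block k' i' = block k i')"
    using assms
  proof (induction k arbitrary: x)
    case 0
    then have "a \<in> set (b # tail i)" by (metis block.simps(1) append_Cons in_set_conv_decomp self_append_conv2)
    then show ?case using set_tail[of i] abc by auto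
  next
    case (Suc k)
    consider "x = []" | "x = [b]" | x' where "x = b # a # x'"
      using Suc.prems by (cases x; cases "tl x") auto
    then show ?case
    proof cases
      case 1
      then show ?thesis using Suc.prems abc by simp
    next
      case 2
      then show ?thesis using Suc.prems by (intro exI[of _ k]) auto
    next
      case 3
      then have "x' @ [a] @ y = block k i" using Suc.prems by simp
      from Suc.IH[OF this] 3 show ?thesis by (metis block.simps(2) append_Cons less_SucI)
    qed
  qed
  then show thesis using that by blast
qed

text \<open>The index only counts repetitions at the end, so a smaller index gives a shorter word on
  the same path. Applied to \<open>unset_bit k i\<close>, this keeps commutators between the two
  roots.\<close>

lemma block_prefix:
  assumes "j < i" shows "\<exists>z. z \<noteq> [] \<and> block k i = block k j @ z"
proof -
  have "\<exists>z. z \<noteq> [] \<and> tail i = tail j @ z" using assms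
  proof (induction j arbitrary: i)
    case 0
    then show ?case by (cases i) (auto simp: tail_Suc tail_0)
  next
    case (Suc j)
    then obtain i' where "i = Suc i'" "j < i'" by (metis Suc_lessE)
    with Suc.IH[of i'] show ?case by (auto simp: tail_Suc)
  qed
  then show ?thesis by (induction k) auto
qed

lemma unset_bit_less: "bit i k \<Longrightarrow> unset_bit k i < (i::nat)"
proof -
  assume "bit i k"
  then have "unset_bit k (int i) \<noteq> int i"
    by (metis bit_of_nat_iff_bit bit_unset_bit_iff)
  then show ?thesis using unset_bit_less_eq[of k "int i"] by (simp flip: of_nat_unset_bit_eq)
qed

text \<open>For \<open>p\<close> ending in \<open>d\<close>, the list \<open>conj_word d y\<close> gives \<open>u\<^sub>p u\<^bsub>py\<^esub> u\<^sub>p\<close> as a product of \<open>u\<^bsub>pz\<^esub>\<close>. Clearing distinct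
  bits of the index \<open>i\<close> are commuting operations, and a bit can be cleared only once; this is what makes
  these relations consistent with each other.\<close>

definition conj_word :: "'a \<Rightarrow> 'a list \<Rightarrow> 'a list list" where
  "conj_word d y = (if \<exists>k i. d = a \<and> k \<in> L \<and> bit i k \<and> y = block k i
     then [y, THE y'. \<exists>k i. y = block k i \<and> y' = block k (unset_bit k i)] else [y])"

lemma conj_word_block: "k \<in> L \<Longrightarrow> bit i k \<Longrightarrow> conj_word a (block k i) = [block k i, block k (unset_bit k i)]"
  unfolding conj_word_def by (auto dest: block_inj intro!: the_equality)

lemma conj_word_not_a: "d \<noteq> a \<Longrightarrow> conj_word d y = [y]"
  by (simp add: conj_word_def)

lemma conj_word_cases:
  obtains "conj_word d y = [y]" "\<And>k i. d = a \<Longrightarrow> k \<in> L \<Longrightarrow> bit i k \<Longrightarrow> y \<noteq> block k i"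
  | k i where "d = a" "k \<in> L" "bit i k" "y = block k i" "conj_word d y = [y, block k (unset_bit k i)]"
proof (cases "\<exists>k i. d = a \<and> k \<in> L \<and> bit i k \<and> y = block k i")
  case True
  then show ?thesis using that(2) conj_word_block by blast
next
  case False
  then show ?thesis using that(1) by (auto simp: conj_word_def)
qed

lemma conj_word_block_not: "\<not> (k \<in> L \<and> bit i k) \<Longrightarrow> conj_word d (block k i) = [block k i]"
  by (rule conj_word_cases[of d "block k i"]) (auto dest: block_inj)

lemma conj_word_prefix: "y' \<in> set (conj_word d y) \<Longrightarrow> prefix y' y"
proof (cases rule: conj_word_cases[of d y])
  case (2 k i)
  then show "prefix y' y" if "y' \<in> set (conj_word d y)"
    using that block_prefix[OF unset_bit_less[OF 2(3)], of k] by (auto simp: prefix_def)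
qed auto

lemma conj_word_last: "y' \<in> set (conj_word d y) \<Longrightarrow> y' = y \<or> last y = c \<and> last y' = c"
  by (rule conj_word_cases[of d y]) auto

lemma conj_word_nonempty: "y' \<in> set (conj_word d y) \<Longrightarrow> y \<noteq> [] \<Longrightarrow> y' \<noteq> []"
  by (rule conj_word_cases[of d y]) auto

definition valid :: "'a list \<Rightarrow> bool" where
  "valid g \<longleftrightarrow> g \<noteq> [] \<and> set g \<subseteq> S \<and> distinct_adj g"

lemma valid_prefix: "valid g \<Longrightarrow> prefix h g \<Longrightarrow> h \<noteq> [] \<Longrightarrow> valid h"
  by (auto simp: valid_def prefix_def)

text \<open>Words over the generators \<open>u\<^sub>g\<close> of \<open>U\<^sub>+\<close>, where the nonempty reduced word \<open>g\<close> stands for the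
  positive root of the last edge on the path labelled \<open>g\<close> that starts at \<open>1\<close> in the tree of \<open>W\<close>.
  Invalid words are made trivial so that no side conditions on words are needed.\<close>

inductive wcong :: "'a list list \<Rightarrow> 'a list list \<Rightarrow> bool" where
  refl: "wcong u u"
| sym: "wcong u v \<Longrightarrow> wcong v u"
| trans: "wcong u v \<Longrightarrow> wcong v w \<Longrightarrow> wcong u w"
| cons: "wcong u v \<Longrightarrow> wcong (g # u) (g # v)"
| invol: "wcong (g # g # u) u"
| invalid: "\<not> valid g \<Longrightarrow> wcong (g # u) u"
| rel: "p = x @ [d] \<Longrightarrow> valid (p @ y) \<Longrightarrow> y \<noteq> [] \<Longrightarrow>
    wcong (p # (p @ y) # p # w) (map ((@) p) (conj_word d y) @ w)"

section \<open>Generators that commute in \<open>U_+\<close>\<close>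

declare wcong.refl [simp, intro]
lemmas [trans] = wcong.trans

lemma wcong_pre: "wcong u v \<Longrightarrow> wcong (w @ u) (w @ v)"
  by (induction w) (auto intro: wcong.cons)

lemma wcong_app: "wcong u v \<Longrightarrow> wcong (u @ w) (v @ w)"
proof (induction rule: wcong.induct)
  case (rel p x d y w')
  then show ?case using wcong.rel[of p x d y "w' @ w"] by simp
qed (auto intro: wcong.intros)

definition commute :: "'a list \<Rightarrow> 'a list \<Rightarrow> bool" where
  "commute u v \<longleftrightarrow> (\<forall>w. wcong (u # v # w) (v # u # w))"

lemma commute_sym: "commute u v \<Longrightarrow> commute v u"
  by (auto simp: commute_def intro: wcong.sym)

lemma commute_prefix:
  assumes "valid v" "prefix u v" "u \<noteq> []" "last u \<noteq> a"
  shows "commute u v"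
proof (cases "u = v")
  case True then show ?thesis by (simp add: commute_def)
next
  case False
  then obtain y where y: "v = u @ y" "y \<noteq> []" using assms by (auto simp: prefix_def)
  show ?thesis unfolding commute_def
  proof
    fix w
    have "wcong (u # v # w) (u # v # u # u # w)" by (intro wcong.cons wcong.sym[OF wcong.invol])
    also have "wcong \<dots> (map ((@) u) (conj_word (last u) y) @ u # w)"
      using wcong.rel[of u "butlast u" "last u" y "u # w"] assms y by simp
    finally show "wcong (u # v # w) (v # u # w)" using assms y by (simp add: conj_word_not_a)
  qed
qed

text \<open>The relation between two generators on a path is governed by the last letter of the
  shorter word; hence the longer word may end in \<open>a\<close>, as the last hypothesis allows for
  \<open>v\<close>.\<close>

lemma commute_comparable:
  assumes "valid g" "prefix u g" "prefix v g" "u \<noteq> []" "v \<noteq> []" "last u \<noteq> a"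
    "last v \<noteq> a \<or> prefix u v"
  shows "commute u v"
proof (cases "prefix u v")
  case True
  then show ?thesis using assms valid_prefix by (intro commute_prefix) auto
next
  case False
  then have "prefix v u" using assms prefix_same_cases by blast
  then show ?thesis using assms valid_prefix False by (intro commute_sym[OF commute_prefix]) auto
qed

lemma commute_slide: "(\<And>u. u \<in> set P \<Longrightarrow> commute u g) \<Longrightarrow> wcong (P @ g # w) (g # P @ w)"
proof (induction P)
  case (Cons u P)
  have "wcong ((u # P) @ g # w) (u # g # P @ w)" using Cons by (auto intro: wcong.cons)
  also have "wcong \<dots> (g # (u # P) @ w)" using Cons.prems[of u] by (auto simp: commute_def)
  finally show ?case .
qed simp

lemma commute_square: "(\<And>u v. u \<in> set P \<Longrightarrow> v \<in> set P \<Longrightarrow> commute u v) \<Longrightarrow> wcong (P @ P @ w) w"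
proof (induction P)
  case (Cons u P)
  have "wcong (u # P @ u # P @ w) (u # u # P @ P @ w)"
    by (intro wcong.cons commute_slide) (use Cons.prems commute_sym in auto)
  also have "wcong \<dots> (P @ P @ w)" by (rule wcong.invol)
  also have "wcong \<dots> w" using Cons by auto
  finally show ?case by simp
qed simp

lemma commute_sandwich:
  assumes "\<And>u v. u \<in> set P \<Longrightarrow> v \<in> set Q \<Longrightarrow> commute u v"
    and "\<And>u v. u \<in> set P \<Longrightarrow> v \<in> set P \<Longrightarrow> commute u v"
  shows "wcong (P @ Q @ P @ w) (Q @ w)"
  using assms(1)
proof (induction Q)
  case Nil
  then show ?case using commute_square[OF assms(2)] by simp
next
  case (Cons g Q)
  have "wcong (P @ g # Q @ P @ w) (g # P @ Q @ P @ w)" using Cons.prems by (intro commute_slide) auto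
  also have "wcong \<dots> (g # Q @ w)" using Cons by (auto intro: wcong.cons)
  finally show ?case by simp
qed

section \<open>Conjugation by \<open>u_s\<close> respects the relations\<close>

definition conj_words :: "'a \<Rightarrow> 'a list list \<Rightarrow> 'a list list" where
  "conj_words s ys = concat (map (conj_word s) ys)"

lemma conj_words_simps [simp]: "conj_words s [] = []" "conj_words s (y # ys) = conj_word s y @ conj_words s ys"
  "conj_words s (u @ v) = conj_words s u @ conj_words s v"
  by (simp_all add: conj_words_def)

abbreviation pre :: "'a list \<Rightarrow> 'a list list \<Rightarrow> 'a list list" where
  "pre q \<equiv> map ((@) q)"

lemma pre_append: "pre (q @ p) ys = pre q (pre p ys)"
  by simp

text \<open>A relation depends only on the last letter of \<open>p\<close> and on \<open>y\<close>,
  so prepending \<open>q\<close> to its words yields another relation. In this form the relations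
  are \<open>W\<close>-equivariant.\<close>

lemma wcong_rel_pre:
  assumes "p = x @ [d]" "valid (q @ p @ y)" "y \<noteq> []"
  shows "wcong ((q @ p) # (q @ p @ y) # (q @ p) # w) (pre q (pre p (conj_word d y)) @ w)"
proof -
  have "wcong ((q @ p) # ((q @ p) @ y) # (q @ p) # w) (pre (q @ p) (conj_word d y) @ w)"
    by (rule wcong.rel[of _ "q @ x"]) (use assms in auto)
  then show ?thesis by (simp only: pre_append append_assoc)
qed

lemma conj_word_commute:
  assumes "valid (q @ y)" "u \<in> set (conj_word s y)" "v \<in> set (conj_word s y)" "y \<noteq> []"
  shows "commute (q @ u) (q @ v)"
proof (cases rule: conj_word_cases[of s y])
  case 1
  then show ?thesis using assms by (simp add: commute_def)
next
  case (2 k i)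
  then have l: "last u = c" "last v = c" "u \<noteq> []" "v \<noteq> []" using assms by auto
  show ?thesis
    by (rule commute_comparable[OF assms(1)]) (use assms l conj_word_prefix abc in auto)
qed

lemma conj_word_square: "valid (q @ y) \<Longrightarrow> y \<noteq> [] \<Longrightarrow> wcong (pre q (conj_word s y) @ pre q (conj_word s y) @ w) w"
  by (rule commute_square) (auto intro: conj_word_commute)

text \<open>A second application adds the shortened word once more and nothing else, since the bit
  is already cleared, and the two equal letters cancel. So conjugating twice by \<open>u_s\<close>
  is trivial, as it must be for an involution.\<close>

lemma conj_words_conj_words: "wcong (pre q (conj_words s (conj_word s y)) @ w) ((q @ y) # w)"
proof (cases rule: conj_word_cases[of s y])
  case (2 k i)
  then have "conj_word s (block k (unset_bit k i)) = [block k (unset_bit k i)]"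
    by (intro conj_word_block_not) (simp add: bit_unset_bit_iff)
  then show ?thesis using 2 by (auto intro: wcong.cons wcong.invol)
qed simp

lemma unset_bit_commute: "unset_bit k (unset_bit k' (i::nat)) = unset_bit k' (unset_bit k i)"
  by (rule bit_eqI) (auto simp: bit_unset_bit_iff)

text \<open>The consistency of the relations: the substitution \<open>conj_word s\<close>, which
  describes how \<open>u_s\<close> conjugates the generators \<open>s # y\<close>, turns a relation
  into a consequence of the relations. In the essential case \<open>s = d = a\<close> both
  conjugations clear bits of the same index, and the two clearings commute.\<close>

lemma conj_words_rel:
  assumes p: "p = x @ [d]" and v: "valid (q @ p @ y)" and y: "y \<noteq> []"
  shows "wcong (pre q (conj_words s [p, p @ y, p]) @ w) (pre q (conj_words s (pre p (conj_word d y))) @ w)"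
proof (cases "s = a")
  case False
  then show ?thesis using wcong_rel_pre[OF p v y, of w] by (simp add: conj_word_not_a conj_words_def concat_map_singleton o_def)
next
  case s: True
  show ?thesis
  proof (cases "d = a")
    case False
    have P: "u \<noteq> [] \<and> last u \<noteq> a \<and> prefix u p" if "u \<in> set (conj_word s p)" for u
      using that conj_word_last[of u s p] conj_word_nonempty[of u s p] conj_word_prefix[of u s p] p False abc by auto
    have Q: "u = p @ y \<or> u \<noteq> [] \<and> last u \<noteq> a \<and> prefix u (p @ y)" if "u \<in> set (conj_word s (p @ y))" for u
      using that conj_word_last[of u s "p @ y"] conj_word_nonempty[of u s "p @ y"] conj_word_prefix[of u s "p @ y"] p abc by auto
    \<comment> \<open>Here the relation says that \<open>p\<close> and \<open>p @ y\<close> commute.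
      All words in their images are prefixes of \<open>p @ y\<close>, and those coming from
      \<open>p\<close> do not end in \<open>a\<close>, so the images commute as well.\<close>
    have "wcong (pre q (conj_word s p) @ pre q (conj_word s (p @ y)) @ pre q (conj_word s p) @ w) (pre q (conj_word s (p @ y)) @ w)"
    proof (rule commute_sandwich)
      fix u v assume "u \<in> set (pre q (conj_word s p))" "v \<in> set (pre q (conj_word s (p @ y)))"
      then obtain u' v' where uv: "u = q @ u'" "v = q @ v'" "u' \<in> set (conj_word s p)" "v' \<in> set (conj_word s (p @ y))"
        by auto
      show "commute u v"
        by (rule commute_comparable[OF v]) (use uv P[of u'] Q[of v'] p y in auto)
    next
      fix u v assume "u \<in> set (pre q (conj_word s p))" "v \<in> set (pre q (conj_word s p))"
      then show "commute u v" using conj_word_commute[of q p] v p valid_prefix[OF v, of "q @ p"] by auto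
    qed
    then show ?thesis using False by (simp add: conj_word_not_a)
  next
    case d: True
    have sp: "conj_word s p = [p]" using p d abc by (cases rule: conj_word_cases[of s p]) (metis last_block last_snoc)+
    have rl: "wcong ((q @ p) # (q @ p @ z) # (q @ p) # w) (pre q (pre p (conj_word d z)) @ w)"
      if "prefix z y" "z \<noteq> []" for z w
      by (rule wcong_rel_pre[OF p]) (use valid_prefix[OF v, of "q @ p @ z"] that in \<open>auto simp: prefix_def\<close>)
    show ?thesis
    proof (cases rule: conj_word_cases[of s "p @ y"])
      case 1
      \<comment> \<open>Clearing a bit sets no other bit: if \<open>s\<close> moved
        \<open>p @ z\<close>, then \<open>p @ y\<close> would be the same block with the original
        index, the relevant bit would be set there too, and \<open>s\<close> would move
        \<open>p @ y\<close>.\<close>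
      have "conj_word s (p @ z) = [p @ z]" if z: "z \<in> set (conj_word d y)" for z
      proof (cases rule: conj_word_cases[of d y])
        case 1
        then show ?thesis using z \<open>conj_word s (p @ y) = [p @ y]\<close> by simp
      next
        case (2 k i)
        show ?thesis
        proof (rule ccontr)
          assume ne: "conj_word s (p @ z) \<noteq> [p @ z]"
          then have z': "z = block k (unset_bit k i)" using z 2 1 by auto
          from ne obtain k' j where k': "k' \<in> L" "bit j k'" "p @ z = block k' j"
            by (cases rule: conj_word_cases[of s "p @ z"]) auto
          then have "x @ [a] @ z = block k' j" using p d by simp
          then obtain k2 where k2: "z = block k2 j" "\<And>i'. x @ [a] @ block k2 i' = block k' i'"
            by (elim block_split) blast
          then have "k2 = k" "j = unset_bit k i" using z' block_inj[of k2 j k "unset_bit k i"] by simp_all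
          then have "p @ y = block k' i" "bit i k'" using k2(2)[of i] p d 2 k'(2) by (auto simp: bit_unset_bit_iff)
          then show False using 1(2) s k'(1) by blast
        qed
      qed
      then have "conj_words s (pre p (conj_word d y)) = pre p (conj_word d y)"
        unfolding conj_words_def by (induction "conj_word d y" rule: rev_induct)
          (auto simp: o_def map_idI concat_map_singleton cong: map_cong)
      then show ?thesis using 1 sp rl[of y w] y by simp
    next
      case (2 k i)
      let ?i1 = "unset_bit k i"
      \<comment> \<open>The last letter \<open>a\<close> of \<open>p\<close> cuts the block
        \<open>p @ y\<close> in two, so \<open>s\<close> acts on bit \<open>k\<close> and
        \<open>p\<close> on the smaller bit \<open>k2\<close> of the same index
        \<open>i\<close>.\<close>
      obtain k2 where k2: "k2 < k" "y = block k2 i" "\<And>i'. x @ [a] @ block k2 i' = block k i'"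
        using block_split[of x y k i] 2(4) p d by auto
      then have pE: "p @ block k2 i' = block k i'" for i' using p d by simp
      define g where "g j = q @ block k j" for j
      have le: "prefix (block k2 j) y" if "j \<le> i" for j
        using that k2(2) block_prefix[of j i k2] by (cases "j = i") (auto simp: prefix_def)
      have gle: "prefix (g j) (q @ p @ y)" if "j \<le> i" for j
        using le[OF that] pE[of j] unfolding g_def by (metis same_prefix_prefix)
      have comg: "commute (g j) (g j')" if "j \<le> i" "j' \<le> i" for j j'
        by (rule commute_comparable[OF v gle gle]) (use that abc in \<open>auto simp: g_def\<close>)
      have i1: "?i1 < i" using 2(3) unset_bit_less by auto
      have r: "wcong ((q @ p) # g j # (q @ p) # w) (pre q (pre p (conj_word a (block k2 j))) @ w)" if "j \<le> i" for j w
        using rl[of "block k2 j" w] le[OF that] d pE by (simp add: g_def)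
      \<comment> \<open>Inserting the square of \<open>q @ p\<close> between the two middle letters
        lets each of them be conjugated separately.\<close>
      have L: "wcong (pre q (conj_words s [p, p @ y, p]) @ w)
         (pre q (pre p (conj_word a (block k2 i))) @ pre q (pre p (conj_word a (block k2 ?i1))) @ w)"
      proof -
        have "pre q (conj_words s [p, p @ y, p]) @ w = (q @ p) # g i # g ?i1 # (q @ p) # w"
          using sp 2 by (simp add: g_def)
        also have "wcong \<dots> ((q @ p) # g i # (q @ p) # (q @ p) # g ?i1 # (q @ p) # w)"
          by (intro wcong.cons wcong.sym[OF wcong.invol])
        also have "wcong \<dots> (pre q (pre p (conj_word a (block k2 i))) @ (q @ p) # g ?i1 # (q @ p) # w)"
          by (rule r) simp
        also have "wcong \<dots> (pre q (pre p (conj_word a (block k2 i))) @ pre q (pre p (conj_word a (block k2 ?i1))) @ w)"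
          by (intro wcong_pre r) (use i1 in simp)
        finally show ?thesis .
      qed
      show ?thesis
      proof (cases "k2 \<in> L \<and> bit i k2")
        case True
        let ?i2 = "unset_bit k2 i" and ?i12 = "unset_bit k2 ?i1"
        have i2: "?i2 < i" using True unset_bit_less by auto
        have b1: "bit ?i1 k2" "bit ?i2 k" using True 2(3) k2(1) by (auto simp: bit_unset_bit_iff)
        \<comment> \<open>Either order of clearing yields the indices \<open>i\<close>,
          \<open>?i1\<close>, \<open>?i2\<close>, \<open>?i12\<close> up to exchanging the two in
          the middle, whose generators commute by \<open>comg\<close>.\<close>
        have "wcong (pre q (pre p (conj_word a (block k2 i))) @ pre q (pre p (conj_word a (block k2 ?i1))) @ w)
          (g i # g ?i1 # g ?i2 # g ?i12 # w)"
          using True b1 comg[of ?i2 ?i1] i1 i2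
          by (simp add: conj_word_block pE flip: g_def) (auto simp: commute_def intro!: wcong.cons)
        also have "\<dots> = pre q (conj_words s (pre p (conj_word d y))) @ w"
          using True b1 2 k2 d s by (simp add: conj_word_block pE unset_bit_commute[of k k2] flip: g_def)
        finally show ?thesis using L wcong.trans by blast
      next
        case False
        then have F: "\<not> (k2 \<in> L \<and> bit ?i1 k2)" by (auto simp: bit_unset_bit_iff)
        have eq: "pre q (pre p (conj_word a (block k2 i))) @ pre q (pre p (conj_word a (block k2 ?i1))) @ w
           = pre q (conj_words s (pre p (conj_word d y))) @ w"
          using False F 2 k2 d s by (simp add: conj_word_block conj_word_block_not pE)
        from L show ?thesis unfolding eq .
      qed
    qed
  qed
qed

end


section \<open>The action of the rank one groups\<close>

context blueprint
begin

text \<open>\<open>letter_img s h y\<close> represents the conjugate by \<open>h \<in> S\<^sub>3 = \<langle>n\<^sub>s, u\<^sub>s\<rangle>\<close> of the generator with word \<open>s # y\<close>.\<close>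

fun letter_img :: "'a \<Rightarrow> s3 \<Rightarrow> 'a list \<Rightarrow> 'a list list" where
  "letter_img s G1 y = [s # y]"
| "letter_img s GU y = pre [s] (conj_word s y)"
| "letter_img s GN y = [y]"
| "letter_img s GNU y = conj_word s y"
| "letter_img s GUN y = [[s], y, [s]]"
| "letter_img s GUNU y = [s] # conj_word s y @ [[s]]"

text \<open>The group \<open>P\<^sub>s = N \<rtimes> S\<^sub>3\<close> acts on the cosets of the rotation subgroup of \<open>S\<^sub>3\<close>, and restricted to
  \<open>U\<^sub>+ = N \<rtimes> \<langle>u\<^sub>s\<rangle>\<close> this action is regular. So \<open>S\<^sub>3\<close> acts on the set \<open>U\<^sub>+\<close>; a word is read from the left
  while the element of \<open>S\<^sub>3\<close> still to be applied is kept as a state.\<close>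

fun transduce :: "'a \<Rightarrow> s3 \<Rightarrow> 'a list list \<Rightarrow> 'a list list" where
  "transduce s g [] = (if s3_odd g then [[s]] else [])"
| "transduce s g (l # v) = (if \<not> valid l then transduce s g v else if l = [s] then transduce s (rmu g) v
     else if hd l = s then letter_img s g (tl l) @ transduce s g v else letter_img s (rmn g) l @ transduce s g v)"

text \<open>For such \<open>y\<close> the generators named \<open>y\<close> and \<open>s # y\<close>
  are exchanged by conjugation with \<open>n_s\<close>. All generators except \<open>[s]\<close>
  occur in such pairs, and \<open>N\<close> is their normal closure in \<open>U_+\<close>.\<close>

definition vtail :: "'a \<Rightarrow> 'a list \<Rightarrow> bool" where
  "vtail s y \<longleftrightarrow> y \<noteq> [] \<and> valid (s # y)"

lemma vtailD: "vtail s y \<Longrightarrow> valid (s # y)" "vtail s y \<Longrightarrow> y \<noteq> []" "vtail s y \<Longrightarrow> valid y"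
  "vtail s y \<Longrightarrow> hd y \<noteq> s" "vtail s y \<Longrightarrow> valid [s]"
  by (auto simp: vtail_def valid_def distinct_adj_Cons)

lemma vtailI: "valid y \<Longrightarrow> s \<in> S \<Longrightarrow> hd y \<noteq> s \<Longrightarrow> vtail s y"
  by (auto simp: vtail_def valid_def distinct_adj_Cons)

lemma valid_cases [consumes 2]:
  assumes "valid l" "s \<in> S"
  obtains "l = [s]" | y where "l = s # y" "vtail s y" | "hd l \<noteq> s" "vtail s l"
  using assms by (cases l) (auto simp: vtail_def valid_def distinct_adj_Cons)

lemma vtail_prefix: "vtail s y \<Longrightarrow> prefix y' y \<Longrightarrow> y' \<noteq> [] \<Longrightarrow> vtail s y'"
  unfolding vtail_def by (auto intro: valid_prefix)

lemma vtail_conj_word: "vtail s y \<Longrightarrow> y' \<in> set (conj_word d y) \<Longrightarrow> vtail s y'"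
  using vtail_prefix conj_word_prefix conj_word_nonempty vtailD(2) by metis

lemma transduce_letter_sub [simp]: "valid [s] \<Longrightarrow> transduce s g ([s] # v) = transduce s (rmu g) v"
  by simp

lemma transduce_letter_pre: "vtail s y \<Longrightarrow> transduce s g ((s # y) # v) = letter_img s g y @ transduce s g v"
  using vtailD[of s y] by simp

lemma transduce_letter_other: "vtail s y \<Longrightarrow> transduce s g (y # v) = letter_img s (rmn g) y @ transduce s g v"
  using vtailD[of s y] by auto

declare transduce.simps(2) [simp del]

lemma transduce_invalid: "\<not> valid l \<Longrightarrow> transduce s g (l # v) = transduce s g v"
  by (simp add: transduce.simps)

section \<open>Images of words under the elements of \<open>S_3\<close>\<close>

definition letter_imgs :: "'a \<Rightarrow> s3 \<Rightarrow> 'a list list \<Rightarrow> 'a list list" where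
  "letter_imgs s g ys = concat (map (letter_img s g) ys)"

lemma letter_imgs_simps [simp]: "letter_imgs s g [] = []" "letter_imgs s g (y # ys) = letter_img s g y @ letter_imgs s g ys"
  by (simp_all add: letter_imgs_def)

lemma transduce_pre: "(\<And>y. y \<in> set ys \<Longrightarrow> vtail s y) \<Longrightarrow> transduce s g (pre [s] ys @ v) = letter_imgs s g ys @ transduce s g v"
  by (induction ys) (auto simp: transduce_letter_pre)

lemma transduce_other: "(\<And>y. y \<in> set ys \<Longrightarrow> vtail s y) \<Longrightarrow> transduce s g (ys @ v) = letter_imgs s (rmn g) ys @ transduce s g v"
  by (induction ys) (auto simp: transduce_letter_other)

lemma wcong_s3: "wcong ([s] # [s] # w) w"
  by (rule wcong.invol)

lemma pre_conj_words: "pre [s] (conj_words s ys) = letter_imgs s GU ys"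
  by (induction ys) auto

lemma letter_imgs_G1: "letter_imgs s G1 ys = pre [s] ys" and letter_imgs_GN: "letter_imgs s GN ys = ys"
  and letter_imgs_GNU: "letter_imgs s GNU ys = conj_words s ys"
  by (induction ys) auto

lemma letter_imgs_GUN: "wcong (letter_imgs s GUN ys @ w) ([s] # ys @ [s] # w)"
proof (induction ys)
  case Nil
  then show ?case by (auto intro: wcong.sym wcong_s3)
next
  case (Cons y ys)
  have "wcong (letter_imgs s GUN (y # ys) @ w) ([s] # y # [s] # [s] # ys @ [s] # w)"
    using Cons by (auto intro: wcong.cons)
  also have "wcong \<dots> ([s] # y # ys @ [s] # w)" by (intro wcong.cons wcong_s3)
  finally show ?case by simp
qed

lemma letter_imgs_GUNU: "wcong (letter_imgs s GUNU ys @ w) ([s] # conj_words s ys @ [s] # w)"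
proof (induction ys)
  case Nil
  then show ?case by (auto intro: wcong.sym wcong_s3)
next
  case (Cons y ys)
  have "wcong (letter_imgs s GUNU (y # ys) @ w) ([s] # conj_word s y @ [s] # [s] # conj_words s ys @ [s] # w)"
    using wcong_pre[OF Cons, of "[s] # conj_word s y @ [[s]]"] by simp
  also have "wcong \<dots> ([s] # conj_word s y @ conj_words s ys @ [s] # w)" by (intro wcong.cons wcong_pre wcong_s3)
  finally show ?case by simp
qed

lemma pre_Nil [simp]: "pre [] ys = ys"
  by (simp add: map_idI)

lemma conj_words_sigs': "vtail s y \<Longrightarrow> wcong (conj_words s (conj_word s y) @ w) (y # w)"
  using conj_words_conj_words[of "[]" s y w] by simp

text \<open>Both sides represent the conjugate of the generator \<open>s # y\<close> by the product
  of \<open>g\<close> and \<open>u_s\<close>; on the left, \<open>conj_word s y\<close> carries out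
  the inner conjugation first.\<close>

lemma letter_imgs_conj_word:
  assumes "vtail s y" shows "wcong (letter_imgs s g (conj_word s y) @ w) (letter_img s (rmu g) y @ w)"
proof (cases g)
  case G1
  then show ?thesis by (simp add: letter_imgs_G1)
next
  case GU
  then show ?thesis using conj_words_conj_words[of "[s]" s y w] by (simp flip: pre_conj_words)
next
  case GN
  then show ?thesis by (simp add: letter_imgs_GN)
next
  case GNU
  then show ?thesis using conj_words_sigs'[OF assms] by (simp add: letter_imgs_GNU)
next
  case GUN
  then show ?thesis using letter_imgs_GUN[of s "conj_word s y" w] by simp
next
  case GUNU
  have "wcong (letter_imgs s GUNU (conj_word s y) @ w) ([s] # conj_words s (conj_word s y) @ [s] # w)" by (rule letter_imgs_GUNU)
  also have "wcong \<dots> ([s] # y # [s] # w)" using assms by (intro wcong.cons conj_words_sigs')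
  finally show ?thesis using GUNU by simp
qed

lemma letter_img_square:
  assumes "vtail s y" shows "wcong (letter_img s g y @ letter_img s g y @ w) w"
proof -
  note v = vtailD[OF assms]
  have sq: "wcong (conj_word s y @ conj_word s y @ w) w" for w using conj_word_square[of "[]" y s w] v by simp
  have conj: "wcong ([s] # u @ [s] # [s] # u @ [s] # w) w" if "\<And>w. wcong (u @ u @ w) w" for u
  proof -
    have "wcong ([s] # u @ [s] # [s] # u @ [s] # w) ([s] # u @ u @ [s] # w)"
      by (intro wcong.cons wcong_pre wcong_s3)
    also have "wcong \<dots> ([s] # [s] # w)" by (intro wcong.cons that)
    also have "wcong \<dots> w" by (rule wcong_s3)
    finally show ?thesis .
  qed
  show ?thesis
  proof (cases g)
    case GU
    then show ?thesis using conj_word_square[of "[s]" y s w] v by simp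
  next
    case GNU
    then show ?thesis using sq by simp
  next
    case GUN
    then show ?thesis using conj[of "[y]"] wcong.invol[of y] by simp
  next
    case GUNU
    then show ?thesis using conj[OF sq] by simp
  qed (auto intro: wcong.invol)
qed

text \<open>For \<open>G1\<close> and \<open>GN\<close> this is the shift invariance
  \<open>wcong_rel_pre\<close>, for \<open>GU\<close> and \<open>GNU\<close> the consistency
  \<open>conj_words_rel\<close>; the two remaining elements arise by a further conjugation with the
  letter \<open>[s]\<close>.\<close>

lemma letter_imgs_rel:
  assumes p: "p = x @ [d]" and v: "vtail s (p @ y)" and y: "y \<noteq> []"
  shows "wcong (letter_imgs s g [p, p @ y, p] @ w) (letter_imgs s g (pre p (conj_word d y)) @ w)"
proof -
  have v': "valid ([s] @ p @ y)" "valid ([] @ p @ y)" using vtailD[OF v] by auto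
  note rel0 = wcong_rel_pre[OF p v'(2) y, unfolded pre_Nil append_Nil] and rel1 = wcong_rel_pre[OF p v'(1) y]
  note sig0 = conj_words_rel[OF p v'(2) y, of s, unfolded pre_Nil append_Nil] and sig1 = conj_words_rel[OF p v'(1) y, of s]
  show ?thesis
  proof (cases g)
    case G1
    then show ?thesis using rel1 by (simp add: letter_imgs_G1)
  next
    case GU
    then show ?thesis using sig1 by (simp only: pre_conj_words)
  next
    case GN
    then show ?thesis using rel0 by (simp add: letter_imgs_GN)
  next
    case GNU
    then show ?thesis unfolding GNU letter_imgs_GNU by (simp only: sig0)
  next
    case GUN
    have "wcong (letter_imgs s GUN [p, p @ y, p] @ w) ([s] # [p, p @ y, p] @ [s] # w)" by (rule letter_imgs_GUN)
    also have "wcong \<dots> ([s] # pre p (conj_word d y) @ [s] # w)" using rel0 by (auto intro: wcong.cons)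
    also have "wcong \<dots> (letter_imgs s GUN (pre p (conj_word d y)) @ w)" by (rule wcong.sym[OF letter_imgs_GUN])
    finally show ?thesis using GUN by simp
  next
    case GUNU
    have "wcong (letter_imgs s GUNU [p, p @ y, p] @ w) ([s] # conj_words s [p, p @ y, p] @ [s] # w)" by (rule letter_imgs_GUNU)
    also have "wcong \<dots> ([s] # conj_words s (pre p (conj_word d y)) @ [s] # w)"
      using sig0 by (intro wcong.cons) (simp del: conj_words_simps)
    also have "wcong \<dots> (letter_imgs s GUNU (pre p (conj_word d y)) @ w)" by (rule wcong.sym[OF letter_imgs_GUNU])
    finally show ?thesis using GUNU by simp
  qed
qed

text \<open>A defining relation is read letter by letter according to whether \<open>p\<close> is
  \<open>[s]\<close>, starts with \<open>s\<close>, or starts with another letter; the lemmas on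
  images settle these cases. It follows that \<open>transduce s g\<close> descends to the set
  \<open>U_+\<close>.\<close>

lemma transduce_cong:
  assumes "wcong u v" "s \<in> S" shows "wcong (transduce s g u) (transduce s g v)"
  using assms(1)
proof (induction arbitrary: g rule: wcong.induct)
  case (sym u v)
  then show ?case by (blast intro: wcong.sym)
next
  case (trans u v w)
  then show ?case by (blast intro: wcong.trans)
next
  case (cons u v l)
  then show ?case by (simp add: transduce.simps wcong_pre)
next
  case (invol l u)
  show ?case
  proof (cases "valid l")
    case True
    from True assms(2) show ?thesis
    proof (cases rule: valid_cases)
      case 1
      then show ?thesis using assms True by simp
    next
      case (2 y)
      then show ?thesis using letter_img_square by (simp add: transduce_letter_pre)
    next
      case 3
      then show ?thesis using letter_img_square by (simp add: transduce_letter_other)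
    qed
  qed (simp add: transduce_invalid)
next
  case (invalid l u)
  then show ?case by (simp add: transduce_invalid)
next
  case (rel p x d y w)
  have "valid p" using valid_prefix[OF rel(2), of p] rel(1) by simp
  from this assms(2) show ?case
  proof (cases rule: valid_cases)
    case 1
    then have d: "d = s" "x = []" "vtail s y" using rel by (auto simp: vtail_def)
    \<comment> \<open>The two letters \<open>[s]\<close> change the state to \<open>rmu g\<close>
      and back, so only \<open>s # y\<close> is read in the state \<open>rmu g\<close>.\<close>
    have "transduce s g (p # (p @ y) # p # w) = letter_img s (rmu g) y @ transduce s g w"
      using 1 d transduce_letter_pre[OF d(3)] vtailD[OF d(3)] by simp
    moreover have "transduce s g (pre p (conj_word d y) @ w) = letter_imgs s g (conj_word s y) @ transduce s g w"
      using transduce_pre[of "conj_word s y" s g w] vtail_conj_word[OF d(3)] 1 d by simp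
    ultimately show ?thesis using letter_imgs_conj_word[OF d(3)] by (metis wcong.sym)
  next
    case (2 p')
    then have v: "vtail s (p' @ y)" using rel by (simp add: vtail_def)
    obtain x' where x': "p' = x' @ [d]" using 2 rel(1) by (cases x) (auto simp: vtail_def)
    have vt: "vtail s z" if "z \<in> set (pre p' (conj_word d y))" for z
      using that vtail_prefix[OF v, of z] conj_word_prefix vtailD(2)[OF 2(2)] by auto
    have "transduce s g (p # (p @ y) # p # w) = letter_imgs s g [p', p' @ y, p'] @ transduce s g w"
      using 2 transduce_letter_pre[OF 2(2)] transduce_letter_pre[OF v] by simp
    moreover have "pre p (conj_word d y) = pre [s] (pre p' (conj_word d y))" using 2(1) by simp
    then have "transduce s g (pre p (conj_word d y) @ w) = letter_imgs s g (pre p' (conj_word d y)) @ transduce s g w"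
      using transduce_pre[of "pre p' (conj_word d y)" s g w, OF vt] by (simp only:)
    ultimately show ?thesis using letter_imgs_rel[OF x' v rel(3)] by metis
  next
    case 3
    then have v: "vtail s (p @ y)" using rel assms vtailD(2) by (intro vtailI) (auto simp: hd_append split: if_splits)
    have vt: "vtail s z" if "z \<in> set (pre p (conj_word d y))" for z
      using that vtail_prefix[OF v, of z] conj_word_prefix vtailD(2)[OF 3(2)] by auto
    have "transduce s g (p # (p @ y) # p # w) = letter_imgs s (rmn g) [p, p @ y, p] @ transduce s g w"
      using 3 transduce_letter_other[OF 3(2)] transduce_letter_other[OF v] by simp
    moreover have "transduce s g (pre p (conj_word d y) @ w) = letter_imgs s (rmn g) (pre p (conj_word d y)) @ transduce s g w"
      using transduce_other[of "pre p (conj_word d y)" s g w, OF vt] by (simp only:)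
    ultimately show ?thesis using letter_imgs_rel[OF rel(1) v rel(3)] by metis
  qed
qed auto

text \<open>From \<open>u_s x = (u_s x u_s) u_s\<close>: moving \<open>[s]\<close> to the right past
  an image turns conjugation by \<open>h\<close> into conjugation by \<open>u_s h\<close>. The cases
  \<open>G1\<close> and \<open>GU\<close> use the relation between \<open>[s]\<close> and
  \<open>s # y\<close>, the others only the square of \<open>[s]\<close>.\<close>

lemma letter_img_lmu:
  assumes "vtail s y" shows "wcong ([s] # letter_img s h y @ w) (letter_img s (lmu h) y @ [s] # w)"
proof -
  note v = vtailD[OF assms]
  have r: "wcong ([s] # (s # y) # w) (pre [s] (conj_word s y) @ [s] # w)" for w
  proof -
    have "wcong ([s] # (s # y) # w) ([s] # (s # y) # [s] # [s] # w)"
      by (intro wcong.cons wcong.sym[OF wcong_s3])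
    also have "wcong \<dots> (pre [s] (conj_word s y) @ [s] # w)"
      using wcong.rel[of "[s]" "[]" s y "[s] # w"] v by simp
    finally show ?thesis .
  qed
  show ?thesis
  proof (cases h)
    case G1
    then show ?thesis using r by simp
  next
    case GU
    have "wcong ([s] # pre [s] (conj_word s y) @ w) ([s] # pre [s] (conj_word s y) @ [s] # [s] # w)"
      by (intro wcong.cons wcong_pre wcong.sym[OF wcong_s3])
    also have "wcong \<dots> ([s] # [s] # (s # y) # [s] # w)"
      by (intro wcong.cons wcong.sym[OF r])
    also have "wcong \<dots> ((s # y) # [s] # w)" by (rule wcong_s3)
    finally show ?thesis using GU by simp
  next
    case GUN
    then show ?thesis by (auto intro: wcong_s3)
  next
    case GUNU
    then show ?thesis by (auto intro: wcong_s3)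
  qed (auto intro!: wcong.cons wcong_pre wcong.sym[OF wcong_s3])
qed

text \<open>The letter \<open>[s]\<close> travels to the end of the output, where it toggles the
  sign of the state. Thus \<open>u_s\<close> as an element of \<open>S_3\<close> acts as left
  multiplication by \<open>u_s\<close> in \<open>U_+\<close>.\<close>

lemma transduce_lmu: "s \<in> S \<Longrightarrow> wcong ([s] # transduce s h v) (transduce s (lmu h) v)"
proof (induction v arbitrary: h)
  case Nil
  then show ?case by (auto intro: wcong_s3)
next
  case (Cons l v)
  have step: "wcong ([s] # letter_img s g y @ transduce s h v) (letter_img s (lmu g) y @ transduce s (lmu h) v)" if "vtail s y" for y g
  proof -
    have "wcong ([s] # letter_img s g y @ transduce s h v) (letter_img s (lmu g) y @ [s] # transduce s h v)" by (rule letter_img_lmu[OF that])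
    also have "wcong \<dots> (letter_img s (lmu g) y @ transduce s (lmu h) v)" by (intro wcong_pre Cons)
    finally show ?thesis .
  qed
  show ?case
  proof (cases "valid l")
    case True
    from True Cons(2) show ?thesis
    proof (cases rule: valid_cases)
      case 1
      then show ?thesis using Cons.IH[of "rmu h"] Cons.prems True by simp
    next
      case (2 y)
      then show ?thesis using step by (simp add: transduce_letter_pre)
    next
      case 3
      then show ?thesis using step[of l "rmn h"] by (simp add: transduce_letter_other)
    qed
  qed (use Cons in \<open>simp add: transduce_invalid\<close>)
qed

text \<open>Reading a letter \<open>[s]\<close> changes the state to \<open>GU\<close>, which by
  \<open>transduce_lmu\<close> amounts to writing that letter in front of the output.\<close>

lemma transduce_G1: "s \<in> S \<Longrightarrow> wcong (transduce s G1 v) v"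
proof (induction v)
  case (Cons l v)
  show ?case
  proof (cases "valid l")
    case True
    from True Cons(2) show ?thesis
    proof (cases rule: valid_cases)
      case 1
      have "wcong (transduce s GU v) ([s] # transduce s G1 v)" using transduce_lmu[OF Cons(2), of G1] by (auto intro: wcong.sym)
      also have "wcong \<dots> ([s] # v)" using Cons by (auto intro: wcong.cons)
      finally show ?thesis using 1 True by simp
    next
      case (2 y)
      then show ?thesis using Cons by (auto simp add: transduce_letter_pre intro: wcong.cons)
    next
      case 3
      then show ?thesis using Cons by (auto simp add: transduce_letter_other intro: wcong.cons)
    qed
  next
    case False
    then show ?thesis using Cons by (simp add: transduce_invalid) (metis wcong.trans wcong.sym wcong.invalid)
  qed
qed auto

lemma transduce_letter_img:
  assumes "vtail s y"
  shows "wcong (transduce s GN (letter_img s h y @ w)) (letter_img s (lmn h) y @ transduce s GN w)"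
proof (cases h)
  case GU
  then show ?thesis using transduce_pre[of "conj_word s y" s GN w] vtail_conj_word[OF assms] by (simp add: letter_imgs_GN)
next
  case GNU
  then show ?thesis using transduce_other[of "conj_word s y" s GN w] vtail_conj_word[OF assms] by (simp add: letter_imgs_G1)
next
  case GUN
  then show ?thesis using vtailD[OF assms] by (simp add: transduce_letter_other[OF assms])
next
  case GUNU
  have "transduce s GN (letter_img s h y @ w) = letter_imgs s GUNU (conj_word s y) @ transduce s GN w"
    using vtailD[OF assms] transduce_other[of "conj_word s y" s GNU "[s] # w"] vtail_conj_word[OF assms] GUNU by simp
  then show ?thesis using letter_imgs_conj_word[OF assms, of GUNU] GUNU by simp
qed (use assms in \<open>auto simp: transduce_letter_pre transduce_letter_other\<close>)

text \<open>The image of a letter contains \<open>[s]\<close> an even number of times, so the second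
  pass is in the state \<open>GN\<close> again after it. With \<open>transduce_lmu\<close> this
  gives the left action of \<open>S_3\<close> on \<open>U_+\<close>.\<close>

lemma transduce_lmn: "s \<in> S \<Longrightarrow> wcong (transduce s GN (transduce s h v)) (transduce s (lmn h) v)"
proof (induction v arbitrary: h)
  case Nil
  then show ?case by (simp add: valid_def)
next
  case (Cons l v)
  have step: "wcong (transduce s GN (letter_img s g y @ transduce s h v)) (letter_img s (lmn g) y @ transduce s (lmn h) v)" if "vtail s y" for y g
  proof -
    have "wcong (transduce s GN (letter_img s g y @ transduce s h v)) (letter_img s (lmn g) y @ transduce s GN (transduce s h v))" by (rule transduce_letter_img[OF that])
    also have "wcong \<dots> (letter_img s (lmn g) y @ transduce s (lmn h) v)" by (intro wcong_pre Cons)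
    finally show ?thesis .
  qed
  show ?case
  proof (cases "valid l")
    case True
    from True Cons(2) show ?thesis
    proof (cases rule: valid_cases)
      case 1
      then show ?thesis using Cons.IH[of "rmu h"] Cons.prems True by simp
    next
      case (2 y)
      then show ?thesis using step by (simp add: transduce_letter_pre)
    next
      case 3
      then show ?thesis using step[of l "rmn h"] by (simp add: transduce_letter_other)
    qed
  qed (use Cons in \<open>simp add: transduce_invalid\<close>)
qed

text \<open>The parity of the number of letters \<open>[d]\<close> is invariant because all new letters introduced by \<open>wcong.rel\<close>
  have length at least two.\<close>

definition pcount :: "'a \<Rightarrow> 'a list list \<Rightarrow> bool" where
  "pcount d v \<longleftrightarrow> odd (count_list v [d])"

lemma length_block: "length (block k i) \<ge> 2"
  by (cases k) (use hd_tail[of i] in auto)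

lemma pcount_cong: "wcong u v \<Longrightarrow> d \<in> S \<Longrightarrow> pcount d u = pcount d v"
proof (induction rule: wcong.induct)
  case (rel p x d' y w)
  have "count_list (pre p (conj_word d' y)) [d] = 0"
    using rel conj_word_nonempty[of "[]" d' y] by (auto simp: count_list_0_iff Cons_eq_append_conv)
  moreover have "p @ y \<noteq> [d]" using rel by (auto simp: append_eq_Cons_conv)
  ultimately show ?case using rel(3) by (simp add: pcount_def)
qed (auto simp: pcount_def valid_def)

end


section \<open>The group generated by the actions\<close>

text \<open>Classes of words in involutive letters form a group, with reversal giving the inverses.
  Over a countable alphabet the classes can be numbered, so the carrier consists of natural numbers
  whatever the type of the letters.\<close>

lemma nat_group_of_words:
  fixes A :: "'l set" and eqv :: "'l list \<Rightarrow> 'l list \<Rightarrow> bool"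
  assumes "countable A" and eqv: "equivp eqv"
    and compat: "\<And>q q' r r'. q \<in> lists A \<Longrightarrow> q' \<in> lists A \<Longrightarrow> r \<in> lists A \<Longrightarrow> r' \<in> lists A \<Longrightarrow>
      eqv q q' \<Longrightarrow> eqv r r' \<Longrightarrow> eqv (q @ r) (q' @ r')"
    and invol: "\<And>l. l \<in> A \<Longrightarrow> eqv [l, l] []"
  obtains G :: "nat monoid" and \<nu> where "group G" "carrier G = \<nu> ` lists A"
    "\<And>q q'. q \<in> lists A \<Longrightarrow> q' \<in> lists A \<Longrightarrow> \<nu> q = \<nu> q' \<longleftrightarrow> eqv q q'"
    "\<And>q q'. q \<in> lists A \<Longrightarrow> q' \<in> lists A \<Longrightarrow> \<nu> (q @ q') = \<nu> q \<otimes>\<^bsub>G\<^esub> \<nu> q'"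
    "\<nu> [] = \<one>\<^bsub>G\<^esub>"
proof -
  define cls where "cls q = {q'. eqv q q'}" for q
  define \<nu> where "\<nu> q = to_nat_on (cls ` lists A) (cls q)" for q
  define rep where "rep k = (SOME q. q \<in> lists A \<and> \<nu> q = k)" for k
  define G :: "nat monoid" where
    "G = \<lparr>carrier = \<nu> ` lists A, monoid.mult = \<lambda>x y. \<nu> (rep x @ rep y), one = \<nu> []\<rparr>"
  have cls_eq: "cls q = cls q' \<longleftrightarrow> eqv q q'" for q q'
    using eqv by (auto simp: cls_def equivp_def)
  have "countable (cls ` lists A)"
    using assms(1) by (intro countable_image countable_lists)
  then have \<nu>_eq: "\<nu> q = \<nu> q' \<longleftrightarrow> eqv q q'" if "q \<in> lists A" "q' \<in> lists A" for q q'
    using inj_on_eq_iff[OF inj_on_to_nat_on, of "cls ` lists A" "cls q" "cls q'"] that cls_eq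
    unfolding \<nu>_def by blast
  have rep: "rep (\<nu> q) \<in> lists A" "\<nu> (rep (\<nu> q)) = \<nu> q" if "q \<in> lists A" for q
    unfolding rep_def using someI_ex[of "\<lambda>q'. q' \<in> lists A \<and> \<nu> q' = \<nu> q"] that by blast+
  have mult: "\<nu> q \<otimes>\<^bsub>G\<^esub> \<nu> q' = \<nu> (q @ q')" if "q \<in> lists A" "q' \<in> lists A" for q q'
  proof -
    have "eqv (rep (\<nu> q) @ rep (\<nu> q')) (q @ q')"
      using rep[OF that(1)] rep[OF that(2)] that \<nu>_eq by (intro compat) blast+
    then show ?thesis using rep[OF that(1)] rep[OF that(2)] that \<nu>_eq by (simp add: G_def)
  qed
  have one: "\<one>\<^bsub>G\<^esub> = \<nu> []" and car: "carrier G = \<nu> ` lists A" by (simp_all add: G_def)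
  have inv: "\<nu> (rev q @ q) = \<nu> []" if "q \<in> lists A" for q
  proof -
    have "eqv (rev q @ q) []" using that
    proof (induction q)
      case Nil
      then show ?case using eqv by (simp add: equivp_reflp)
    next
      case (Cons l q)
      then have l: "l \<in> A" "q \<in> lists A" "rev q \<in> lists A" by auto
      have "eqv ([l, l] @ q) ([] @ q)"
        by (rule compat) (use l invol eqv in \<open>auto intro: equivp_reflp\<close>)
      then have "eqv (rev q @ ([l, l] @ q)) (rev q @ ([] @ q))"
        by (intro compat[of "rev q" "rev q" "[l, l] @ q" "[] @ q"])
          (use l eqv in \<open>auto intro: equivp_reflp\<close>)
      then show ?case using Cons.IH eqv by (simp add: equivp_def)
    qed
    moreover have "rev q \<in> lists A" using that by (auto simp: in_lists_conv_set)
    ultimately show ?thesis using \<nu>_eq[of "rev q @ q" "[]"] that by auto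
  qed
  have "group G"
  proof (rule groupI)
    fix x assume "x \<in> carrier G"
    then obtain q where q: "q \<in> lists A" "x = \<nu> q" by (auto simp: car)
    moreover from q have "rev q \<in> lists A" by (auto simp: in_lists_conv_set)
    ultimately show "\<exists>y\<in>carrier G. y \<otimes>\<^bsub>G\<^esub> x = \<one>\<^bsub>G\<^esub>"
      using mult[of "rev q" q] inv by (auto simp: one car intro!: bexI[of _ "rev q"])
  next
    fix x y assume "x \<in> carrier G" "y \<in> carrier G"
    then obtain q r where q: "q \<in> lists A" "r \<in> lists A" "x = \<nu> q" "y = \<nu> r" by (auto simp: car)
    then have "q @ r \<in> lists A" by simp
    then show "x \<otimes>\<^bsub>G\<^esub> y \<in> carrier G" using q mult unfolding car by (metis imageI)
  next
    fix x y z assume "x \<in> carrier G" "y \<in> carrier G" "z \<in> carrier G"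
    then obtain q r t where q: "q \<in> lists A" "r \<in> lists A" "t \<in> lists A" "x = \<nu> q" "y = \<nu> r" "z = \<nu> t"
      unfolding car by blast
    then have "q @ r \<in> lists A" "r @ t \<in> lists A" by auto
    then show "x \<otimes>\<^bsub>G\<^esub> y \<otimes>\<^bsub>G\<^esub> z = x \<otimes>\<^bsub>G\<^esub> (y \<otimes>\<^bsub>G\<^esub> z)"
      using q mult by (metis append_assoc)
  qed (auto simp: car mult one in_lists_conv_set)
  then show thesis using that car \<nu>_eq mult one by metis
qed

text \<open>The element \<open>u\<close> of the last letter, conjugated by the \<open>n\<close> of
  the letters before it; it belongs to the last edge of the path. As the \<open>n s\<close> are
  going to be involutions, no inverses appear. The empty word names no root and gets a default
  value.\<close>

fun root_elt :: "('g, 'c) monoid_scheme \<Rightarrow> ('a \<Rightarrow> 'g) \<Rightarrow> ('a \<Rightarrow> 'g) \<Rightarrow> 'a list \<Rightarrow> 'g" where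
  "root_elt G n u [] = \<one>\<^bsub>G\<^esub>"
| "root_elt G n u [s] = u s"
| "root_elt G n u (s # t # g) = n s \<otimes>\<^bsub>G\<^esub> root_elt G n u (t # g) \<otimes>\<^bsub>G\<^esub> n s"

text \<open>The properties of \<open>G\<close> from which the RGD axioms are derived.
  \<open>braid\<close> is the relation \<open>(n_s u_s)^3 = 1\<close>, written so that
  \<open>n_s\<close> appears as the product \<open>u' u u''\<close> of (RGD2);
  \<open>neg_not_pos\<close> prepares (RGD3).\<close>

locale blueprint_group = blueprint S a b c L + G: group G
  for S :: "'a set" and a b c L and G :: "('g, 'h) monoid_scheme" (structure) +
  fixes n u :: "'a \<Rightarrow> 'g"
  assumes n_closed: "s \<in> S \<Longrightarrow> n s \<in> carrier G" and u_closed: "s \<in> S \<Longrightarrow> u s \<in> carrier G"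
    and n_sq: "s \<in> S \<Longrightarrow> n s \<otimes>\<^bsub>G\<^esub> n s = \<one>\<^bsub>G\<^esub>" and u_sq: "s \<in> S \<Longrightarrow> u s \<otimes>\<^bsub>G\<^esub> u s = \<one>\<^bsub>G\<^esub>"
    and braid: "s \<in> S \<Longrightarrow>
      (n s \<otimes>\<^bsub>G\<^esub> u s \<otimes>\<^bsub>G\<^esub> n s) \<otimes>\<^bsub>G\<^esub> u s \<otimes>\<^bsub>G\<^esub> (n s \<otimes>\<^bsub>G\<^esub> u s \<otimes>\<^bsub>G\<^esub> n s) = n s"
    and generated: "carrier G \<subseteq> generate G (n ` S \<union> u ` S)"
    and rel: "valid (x @ [d] @ y) \<Longrightarrow> y \<noteq> [] \<Longrightarrow>
      root_elt G n u (x @ [d]) \<otimes>\<^bsub>G\<^esub> root_elt G n u (x @ [d] @ y) \<otimes>\<^bsub>G\<^esub> root_elt G n u (x @ [d]) =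
      foldr (\<otimes>\<^bsub>G\<^esub>) (map (\<lambda>z. root_elt G n u (x @ [d] @ z)) (conj_word d y)) \<one>\<^bsub>G\<^esub>"
    and u_nontrivial: "s \<in> S \<Longrightarrow> u s \<noteq> \<one>\<^bsub>G\<^esub>"
    and neg_not_pos: "s \<in> S \<Longrightarrow>
      n s \<otimes>\<^bsub>G\<^esub> u s \<otimes>\<^bsub>G\<^esub> n s \<notin> generate G (root_elt G n u ` {g. valid g})"

section \<open>Words in the \<open>n_s\<close> and \<open>u_s\<close> acting on
  \<open>U_+\<close>\<close>

context blueprint
begin

text \<open>The letter \<open>(s, True)\<close> stands for \<open>u_s\<close>, and
  \<open>(s, False)\<close> for \<open>n_s\<close>.\<close>

fun act :: "'a \<times> bool \<Rightarrow> 'a list list \<Rightarrow> 'a list list" where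
  "act (s, True) v = [s] # v"
| "act (s, False) v = transduce s GN v"

definition acts :: "('a \<times> bool) list \<Rightarrow> 'a list list \<Rightarrow> 'a list list" where
  "acts q v = foldr act q v"

definition aeq :: "('a \<times> bool) list \<Rightarrow> ('a \<times> bool) list \<Rightarrow> bool" where
  "aeq q q' \<longleftrightarrow> (\<forall>v. wcong (acts q v) (acts q' v))"

abbreviation "letters \<equiv> S \<times> (UNIV :: bool set)"

lemma acts_simps [simp]: "acts [] v = v" "acts (l # q) v = act l (acts q v)"
  "acts (q @ q') v = acts q (acts q' v)"
  by (simp_all add: acts_def)

lemma act_cong: "l \<in> letters \<Longrightarrow> wcong v w \<Longrightarrow> wcong (act l v) (act l w)"
  by (cases "(l, v)" rule: act.cases) (auto intro: transduce_cong wcong.cons)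

lemma acts_cong: "q \<in> lists letters \<Longrightarrow> wcong v w \<Longrightarrow> wcong (acts q v) (acts q w)"
  by (induction q) (auto intro: act_cong)

lemma transduce_transduce: "s \<in> S \<Longrightarrow> wcong (transduce s GN (transduce s GN v)) v"
  using transduce_lmn[of s GN v] transduce_G1[of s v] by (auto intro: wcong.trans)

lemma transduce_neg: "s \<in> S \<Longrightarrow> wcong (transduce s GN ([s] # transduce s GN v)) (transduce s GUNU v)"
proof -
  assume s: "s \<in> S"
  have "wcong (transduce s GN ([s] # transduce s GN v)) (transduce s GN (transduce s GUN v))"
    using s transduce_lmu[OF s, of GN v] by (intro transduce_cong) auto
  also have "wcong \<dots> (transduce s GUNU v)" using transduce_lmn[OF s, of GUN v] by simp
  finally show ?thesis .
qed

lemma transduce_braid: "s \<in> S \<Longrightarrow> wcong (transduce s GUNU ([s] # transduce s GUNU v)) (transduce s GN v)"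
proof -
  assume s: "s \<in> S"
  have "wcong (transduce s GUNU ([s] # transduce s GUNU v)) (transduce s GUNU (transduce s GNU v))"
    using s transduce_lmu[OF s, of GUNU v] by (intro transduce_cong) auto
  also have "wcong \<dots> (transduce s GN ([s] # transduce s GN (transduce s GNU v)))" by (intro wcong.sym[OF transduce_neg] s)
  also have "wcong \<dots> (transduce s GN ([s] # transduce s GU v))"
    using transduce_lmn[OF s, of GNU v] by (intro transduce_cong wcong.cons s) simp
  also have "wcong \<dots> (transduce s GN (transduce s G1 v))"
    using transduce_lmu[OF s, of GU v] by (intro transduce_cong s) simp
  also have "wcong \<dots> (transduce s GN v)" by (intro transduce_cong transduce_G1 s)
  finally show ?thesis .
qed

fun root_word :: "'a list \<Rightarrow> ('a \<times> bool) list" where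
  "root_word [] = []"
| "root_word [s] = [(s, True)]"
| "root_word (s # t # g) = (s, False) # root_word (t # g) @ [(s, False)]"

lemma root_word_letters: "set g \<subseteq> S \<Longrightarrow> root_word g \<in> lists letters"
  by (induction g rule: root_word.induct) auto

text \<open>Conjugation by \<open>n_s\<close> prepends \<open>s\<close> to the name of a generator,
  so a root element acts on \<open>U_+\<close> as a left multiplication. This carries the relations
  between positive roots over to the permutation group.\<close>

lemma acts_root_word: "valid g \<Longrightarrow> wcong (acts (root_word g) v) (g # v)"
proof (induction g arbitrary: v rule: root_word.induct)
  case (3 s t g)
  then have v: "vtail s (t # g)" "s \<in> S" "valid (t # g)" by (auto simp: vtail_def valid_def)
  have "wcong (acts (root_word (s # t # g)) v) (transduce s GN ((t # g) # transduce s GN v))"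
    using 3 v by (auto intro: transduce_cong)
  also have "wcong \<dots> ((s # t # g) # transduce s GN (transduce s GN v))" by (simp add: transduce_letter_other[OF v(1)])
  also have "wcong \<dots> ((s # t # g) # v)" by (intro wcong.cons transduce_transduce v)
  finally show ?case .
qed (auto simp: valid_def)

text \<open>A left multiplication is determined by its value at \<open>1\<close>, which forces
  \<open>w\<close> to represent \<open>u_s\<close>. On the generator named \<open>[s, d]\<close> the
  two maps then give the products \<open>[s] [d]\<close> and \<open>[s] [s, d]\<close>, which differ
  in the parity of the letter \<open>[d]\<close>.\<close>

lemma neg_not_translation:
  assumes "s \<in> S" shows "\<exists>v. \<not> wcong (transduce s GUNU v) (w @ v)"
proof -
  obtain d where d: "d \<in> S" "d \<noteq> s" using abc by metis
  have v: "vtail s [d]" using assms d by (auto simp: vtail_def valid_def)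
  have sd: "conj_word s [d] = [[d]]"
  proof (rule conj_word_cases[of s "[d]"])
    fix k i assume "[d] = block k i"
    from length_block[of k i, folded this] show ?thesis by simp
  qed
  show "\<exists>v. \<not> wcong (transduce s GUNU v) (w @ v)"
  proof (rule ccontr)
    assume "\<not> ?thesis"
    then have all: "wcong (transduce s GUNU v) (w @ v)" for v by blast
    have *: "wcong w [[s]]" using all[of "[]"] by (auto intro: wcong.sym)
    have "wcong ([s] # [d] # [s] # [[s]]) (transduce s GUNU [s # [d]])"
      using transduce_letter_pre[OF v, of GUNU "[]"] by (simp add: sd)
    also have "wcong \<dots> (w @ [s # [d]])" by (rule all)
    also have "wcong \<dots> ([[s]] @ [s # [d]])" by (rule wcong_app[OF *])
    finally have "pcount d ([s] # [d] # [s] # [[s]]) = pcount d ([[s]] @ [s # [d]])"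
      using d by (intro pcount_cong)
    then show False using d by (simp add: pcount_def)
  qed
qed

text \<open>Equality in \<open>G\<close> means equal action on \<open>U_+\<close>. As root elements
  act by left multiplication, relations of \<open>wcong\<close> hold in \<open>G\<close>;
  conversely, an equation in \<open>G\<close> is refuted by evaluating it on words and comparing
  parities.\<close>

theorem blueprint_group_exists:
  assumes "countable S"
  obtains G :: "nat monoid" and n u where "blueprint_group S a b c L G n u"
proof -
  have "equivp aeq"
    by (rule equivpI) (auto simp: aeq_def reflp_def symp_def transp_def intro: wcong.sym wcong.trans)
  moreover have "aeq (q @ r) (q' @ r')"
    if "q \<in> lists letters" "q' \<in> lists letters" "r \<in> lists letters" "r' \<in> lists letters" "aeq q q'" "aeq r r'"
    for q q' r r'
    using that acts_cong[OF that(1)] unfolding aeq_def acts_simps by (blast intro: wcong.trans)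
  moreover have "aeq [l, l] []" if "l \<in> letters" for l
    using that by (cases l; cases "snd l") (auto simp: aeq_def intro: wcong.invol transduce_transduce)
  moreover have "countable letters" using assms by auto
  ultimately obtain G :: "nat monoid" and \<nu> where G: "group G" and car: "carrier G = \<nu> ` lists letters"
    and eq: "\<And>q q'. q \<in> lists letters \<Longrightarrow> q' \<in> lists letters \<Longrightarrow> \<nu> q = \<nu> q' \<longleftrightarrow> aeq q q'"
    and app: "\<And>q q'. q \<in> lists letters \<Longrightarrow> q' \<in> lists letters \<Longrightarrow> \<nu> (q @ q') = \<nu> q \<otimes>\<^bsub>G\<^esub> \<nu> q'"
    and one: "\<nu> [] = \<one>\<^bsub>G\<^esub>"
    using nat_group_of_words[of letters aeq] by blast
  interpret G: group G by (rule G)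
  define n u where "n s = \<nu> [(s, False)]" and "u s = \<nu> [(s, True)]" for s
  let ?r = "root_elt G n u"
  have nu: "n s \<in> carrier G" "u s \<in> carrier G" if "s \<in> S" for s
    using that by (auto simp: car n_def u_def)
  have \<nu>_root: "\<nu> (root_word g) = ?r g" if "set g \<subseteq> S" for g
    using that
  proof (induction g rule: root_word.induct)
    case (3 s t g)
    then have "root_word (t # g) \<in> lists letters" by (intro root_word_letters) auto
    then show ?case
      using 3 app[of "[(s, False)] @ root_word (t # g)" "[(s, False)]"]
        app[of "[(s, False)]" "root_word (t # g)"] by (auto simp: n_def)
  qed (auto simp: one u_def)
  have r_closed: "?r g \<in> carrier G" if "valid g" for g
    using that \<nu>_root[of g] root_word_letters[of g] unfolding car valid_def by (metis imageI)
  have \<nu>_fold: "\<nu> (concat qs) = foldr (\<otimes>\<^bsub>G\<^esub>) (map \<nu> qs) \<one>\<^bsub>G\<^esub>" if "set qs \<subseteq> lists letters" for qs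
    using that
  proof (induction qs)
    case (Cons q qs)
    moreover from Cons have "concat qs \<in> lists letters" by fastforce
    ultimately show ?case using app[of q "concat qs"] by simp
  qed (simp add: one)
  have acts_fold: "wcong (acts (concat (map root_word gs)) v) (gs @ v)" if "\<forall>g\<in>set gs. valid g" for gs v
    using that
  proof (induction gs arbitrary: v)
    case (Cons g gs)
    then have g: "valid g" and l: "root_word g \<in> lists letters" using root_word_letters[of g] by (auto simp: valid_def)
    have "wcong (acts (root_word g) (acts (concat (map root_word gs)) v)) (acts (root_word g) (gs @ v))"
      using Cons by (intro acts_cong[OF l]) auto
    also have "wcong \<dots> (g # gs @ v)" by (rule acts_root_word[OF g])
    finally show ?case by simp
  qed simp
  have fold_root: "foldr (\<otimes>\<^bsub>G\<^esub>) (map ?r gs) \<one>\<^bsub>G\<^esub> = \<nu> (concat (map root_word gs))"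
    "concat (map root_word gs) \<in> lists letters" if "\<forall>g\<in>set gs. valid g" for gs
  proof -
    have *: "set g \<subseteq> S \<and> root_word g \<in> lists letters" if "g \<in> set gs" for g
      using that \<open>\<forall>g\<in>set gs. valid g\<close> root_word_letters[of g] by (auto simp: valid_def)
    then show "concat (map root_word gs) \<in> lists letters" by fastforce
    have m: "map ?r gs = map \<nu> (map root_word gs)" using * \<nu>_root by auto
    have "set (map root_word gs) \<subseteq> lists letters" using * by auto
    from \<nu>_fold[OF this] show "foldr (\<otimes>\<^bsub>G\<^esub>) (map ?r gs) \<one>\<^bsub>G\<^esub> = \<nu> (concat (map root_word gs))"
      unfolding m by simp
  qed
  have wcong_eq: "foldr (\<otimes>\<^bsub>G\<^esub>) (map ?r gs) \<one>\<^bsub>G\<^esub> = foldr (\<otimes>\<^bsub>G\<^esub>) (map ?r hs) \<one>\<^bsub>G\<^esub>"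
    if "\<forall>g\<in>set gs. valid g" "\<forall>g\<in>set hs. valid g" "\<And>v. wcong (gs @ v) (hs @ v)" for gs hs
  proof -
    have "aeq (concat (map root_word gs)) (concat (map root_word hs))"
      unfolding aeq_def
    proof
      fix v
      have "wcong (acts (concat (map root_word gs)) v) (gs @ v)" by (rule acts_fold[OF that(1)])
      also have "wcong \<dots> (hs @ v)" by (rule that(3))
      also have "wcong \<dots> (acts (concat (map root_word hs)) v)" by (rule wcong.sym[OF acts_fold[OF that(2)]])
      finally show "wcong (acts (concat (map root_word gs)) v) (acts (concat (map root_word hs)) v)" .
    qed
    then show ?thesis using fold_root[OF that(1)] fold_root[OF that(2)] eq by metis
  qed
  have neg: "n s \<otimes>\<^bsub>G\<^esub> u s \<otimes>\<^bsub>G\<^esub> n s = \<nu> [(s, False), (s, True), (s, False)]" if "s \<in> S" for s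
    using that app[of "[(s, False)]" "[(s, True)]"] app[of "[(s, False), (s, True)]" "[(s, False)]"]
    by (auto simp: n_def u_def)
  have "blueprint_group S a b c L G n u"
  proof unfold_locales
    fix s assume s: "s \<in> S"
    show "n s \<in> carrier G" "u s \<in> carrier G" using nu s by auto
    show "n s \<otimes>\<^bsub>G\<^esub> n s = \<one>\<^bsub>G\<^esub>"
      using s app[of "[(s, False)]" "[(s, False)]"] one
      by (auto simp: n_def eq aeq_def transduce_transduce simp flip: app one)
    show "u s \<otimes>\<^bsub>G\<^esub> u s = \<one>\<^bsub>G\<^esub>"
      using s by (auto simp: u_def eq aeq_def wcong.invol simp flip: app one)
    let ?q = "[(s, False), (s, True), (s, False)]"
    have q: "wcong (acts ?q v) (transduce s GUNU v)" for v using transduce_neg[OF s] by simp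
    have "aeq (?q @ [(s, True)] @ ?q) [(s, False)]"
      unfolding aeq_def
    proof
      fix v
      have "wcong (acts (?q @ [(s, True)] @ ?q) v) (transduce s GUNU ([s] # transduce s GUNU v))"
      proof -
        have "acts (?q @ [(s, True)] @ ?q) v = acts ?q ([s] # acts ?q v)" by simp
        also have "wcong \<dots> (transduce s GUNU ([s] # acts ?q v))" by (rule q)
        also have "wcong \<dots> (transduce s GUNU ([s] # transduce s GUNU v))" by (intro transduce_cong wcong.cons q s)
        finally show ?thesis .
      qed
      also have "wcong \<dots> (transduce s GN v)" by (rule transduce_braid[OF s])
      finally show "wcong (acts (?q @ [(s, True)] @ ?q) v) (acts [(s, False)] v)" by simp
    qed
    then show "(n s \<otimes>\<^bsub>G\<^esub> u s \<otimes>\<^bsub>G\<^esub> n s) \<otimes>\<^bsub>G\<^esub> u s \<otimes>\<^bsub>G\<^esub> (n s \<otimes>\<^bsub>G\<^esub> u s \<otimes>\<^bsub>G\<^esub> n s) = n s"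
      using s eq[of "?q @ [(s, True)] @ ?q" "[(s, False)]"] app[of ?q "[(s, True)]"]
        app[of "?q @ [(s, True)]" ?q] neg[OF s] by (simp add: n_def u_def)
    show "u s \<noteq> \<one>\<^bsub>G\<^esub>"
    proof
      assume "u s = \<one>\<^bsub>G\<^esub>"
      then have "wcong [[s]] []" using s eq[of "[(s, True)]" "[]"] by (auto simp: u_def aeq_def simp flip: one)
      from pcount_cong[OF this s] show False by (simp add: pcount_def)
    qed
    \<comment> \<open>Positive root elements are involutions, so the subgroup they generate consists
      of products without inverses, which act as left multiplications by words.\<close>
    have pos: "\<exists>gs. (\<forall>g\<in>set gs. valid g) \<and> x = foldr (\<otimes>\<^bsub>G\<^esub>) (map ?r gs) \<one>\<^bsub>G\<^esub>"
      if "x \<in> generate G (?r ` {g. valid g})" for x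
      using that
    proof (induction rule: generate.induct)
      case one
      show ?case by (rule exI[of _ "[]"]) simp
    next
      case (incl h)
      then obtain g where g: "h = ?r g" "valid g" by auto
      then have "h \<in> carrier G" using r_closed by simp
      then show ?case using g by (intro exI[of _ "[g]"]) auto
    next
      case (inv h)
      then obtain g where g: "h = ?r g" "valid g" by auto
      then have h: "h \<in> carrier G" using r_closed by simp
      have "h \<otimes>\<^bsub>G\<^esub> h = \<one>\<^bsub>G\<^esub>" using wcong_eq[of "[g, g]" "[]"] g h wcong.invol by simp
      then have "inv\<^bsub>G\<^esub> h = h" using h by (intro G.inv_equality) auto
      then show ?case using g h by (intro exI[of _ "[g]"]) auto
    next
      case (eng h1 h2)
      then obtain gs1 gs2 where gs: "\<forall>g\<in>set (gs1 @ gs2). valid g"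
        "h1 = foldr (\<otimes>\<^bsub>G\<^esub>) (map ?r gs1) \<one>\<^bsub>G\<^esub>" "h2 = foldr (\<otimes>\<^bsub>G\<^esub>) (map ?r gs2) \<one>\<^bsub>G\<^esub>" by auto
      then have "h1 \<otimes>\<^bsub>G\<^esub> h2 = foldr (\<otimes>\<^bsub>G\<^esub>) (map ?r (gs1 @ gs2)) \<one>\<^bsub>G\<^esub>"
        using fold_root[of gs1] fold_root[of gs2] fold_root[of "gs1 @ gs2"]
          app[of "concat (map root_word gs1)" "concat (map root_word gs2)"] by auto
      then show ?case using gs(1) by blast
    qed
    show "n s \<otimes>\<^bsub>G\<^esub> u s \<otimes>\<^bsub>G\<^esub> n s \<notin> generate G (?r ` {g. valid g})"
    proof
      assume "n s \<otimes>\<^bsub>G\<^esub> u s \<otimes>\<^bsub>G\<^esub> n s \<in> generate G (?r ` {g. valid g})"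
      then obtain gs where gs: "\<forall>g\<in>set gs. valid g" "\<nu> ?q = \<nu> (concat (map root_word gs))"
        using pos neg[OF s] fold_root(1) by metis
      then have "wcong (acts ?q v) (acts (concat (map root_word gs)) v)" for v
        using s eq[of ?q "concat (map root_word gs)"] fold_root(2)[OF gs(1)] by (auto simp: aeq_def)
      then have "wcong (transduce s GUNU v) (gs @ v)" for v
        using acts_fold[OF gs(1)] q by (blast intro: wcong.trans wcong.sym)
      then show False using neg_not_translation[OF s] by blast
    qed
  next
    show "carrier G \<subseteq> generate G (n ` S \<union> u ` S)"
    proof
      fix x assume "x \<in> carrier G"
      then obtain q where "q \<in> lists letters" "x = \<nu> q" by (auto simp: car)
      then show "x \<in> generate G (n ` S \<union> u ` S)"
      proof (induction q arbitrary: x)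
        case Nil
        then show ?case by (simp add: one generate.one)
      next
        case (Cons l q)
        have "\<nu> [l] \<in> n ` S \<union> u ` S" using Cons.hyps by (cases l; cases "snd l") (auto simp: n_def u_def)
        then show ?case using Cons app[of "[l]" q] by (auto intro: generate.eng generate.incl)
      qed
    qed
  next
    fix x d y assume v: "valid (x @ [d] @ y)" and y: "y \<noteq> []"
    have val: "\<forall>g\<in>set [x @ [d], x @ [d] @ y, x @ [d]]. valid g"
      "\<forall>g\<in>set (pre (x @ [d]) (conj_word d y)). valid g"
      using v valid_prefix[OF v] conj_word_prefix[of _ d y] by auto
    have "foldr (\<otimes>\<^bsub>G\<^esub>) (map ?r [x @ [d], x @ [d] @ y, x @ [d]]) \<one>\<^bsub>G\<^esub> =
      foldr (\<otimes>\<^bsub>G\<^esub>) (map ?r (pre (x @ [d]) (conj_word d y))) \<one>\<^bsub>G\<^esub>"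
      by (rule wcong_eq[OF val]) (use wcong.rel[of "x @ [d]" x d y] v y in simp)
    then show "?r (x @ [d]) \<otimes>\<^bsub>G\<^esub> ?r (x @ [d] @ y) \<otimes>\<^bsub>G\<^esub> ?r (x @ [d]) =
      foldr (\<otimes>\<^bsub>G\<^esub>) (map (\<lambda>z. ?r (x @ [d] @ z)) (conj_word d y)) \<one>\<^bsub>G\<^esub>"
      using val(1) r_closed by (simp add: o_def G.m_assoc)
  qed
  then show thesis using that by blast
qed

end


section \<open>Nilpotency\<close>

context group
begin

definition comm :: "'a \<Rightarrow> 'a \<Rightarrow> 'a" where
  "comm x y = x \<otimes> y \<otimes> inv x \<otimes> inv y"

lemma comm_closed [simp]: "x \<in> carrier G \<Longrightarrow> y \<in> carrier G \<Longrightarrow> comm x y \<in> carrier G"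
  by (simp add: comm_def)

lemma comm_one [simp]: "x \<in> carrier G \<Longrightarrow> comm x \<one> = \<one>" "x \<in> carrier G \<Longrightarrow> comm \<one> x = \<one>"
  by (simp_all add: comm_def)

lemma inv_comm: "x \<in> carrier G \<Longrightarrow> y \<in> carrier G \<Longrightarrow> inv (comm x y) = comm y x"
  by (simp add: comm_def inv_mult_group m_assoc)

lemma cancel_left: "x \<in> carrier G \<Longrightarrow> y \<in> carrier G \<Longrightarrow> x \<otimes> (inv x \<otimes> y) = y"
  "x \<in> carrier G \<Longrightarrow> y \<in> carrier G \<Longrightarrow> inv x \<otimes> (x \<otimes> y) = y"
  by (simp_all flip: m_assoc)

lemma conj_comm:
  assumes "g \<in> carrier G" "x \<in> carrier G" "y \<in> carrier G"
  shows "comm (g \<otimes> x \<otimes> inv g) (g \<otimes> y \<otimes> inv g) = g \<otimes> comm x y \<otimes> inv g"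
  using assms by (simp add: comm_def inv_mult_group m_assoc cancel_left)

lemma conj_in_generate:
  assumes "Q \<subseteq> carrier G" "g \<in> carrier G" "\<And>q. q \<in> Q \<Longrightarrow> g \<otimes> q \<otimes> inv g \<in> generate G R"
    and "R \<subseteq> carrier G" "x \<in> generate G Q"
  shows "g \<otimes> x \<otimes> inv g \<in> generate G R"
proof -
  interpret N: subgroup "generate G R" G using assms by (rule_tac generate_is_subgroup)
  have "x \<in> carrier G \<and> g \<otimes> x \<otimes> inv g \<in> generate G R" using assms(5)
  proof (induction rule: generate.induct)
    case one
    then show ?case using assms by simp
  next
    case (incl h)
    then show ?case using assms by auto
  next
    case (inv h)
    then have h: "h \<in> carrier G" using assms(1) by auto
    then have "g \<otimes> inv h \<otimes> inv g = inv (g \<otimes> h \<otimes> inv g)"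
      using assms(2) by (simp add: inv_mult_group m_assoc)
    then show ?case using inv h assms by simp
  next
    case (eng h1 h2)
    then have "g \<otimes> (h1 \<otimes> h2) \<otimes> inv g = (g \<otimes> h1 \<otimes> inv g) \<otimes> (g \<otimes> h2 \<otimes> inv g)"
      using assms(2) by (simp add: m_assoc cancel_left)
    then show ?case using eng by simp
  qed
  then show ?thesis ..
qed

lemma generate_normalizes:
  assumes R: "R \<subseteq> carrier G" and Q: "Q \<subseteq> carrier G" "\<And>q. q \<in> Q \<Longrightarrow> inv q = q"
    and conj: "\<And>q r. q \<in> Q \<Longrightarrow> r \<in> R \<Longrightarrow> q \<otimes> r \<otimes> inv q \<in> generate G R"
    and g: "g \<in> generate G Q"
  shows "\<forall>x\<in>generate G R. g \<otimes> x \<otimes> inv g \<in> generate G R"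
proof -
  interpret N: subgroup "generate G R" G using R by (rule generate_is_subgroup)
  have base: "h \<in> carrier G \<and> (\<forall>x\<in>generate G R. h \<otimes> x \<otimes> inv h \<in> generate G R)" if "h \<in> Q" for h
    using conj_in_generate[OF R _ _ R, of h] conj[OF that] Q(1) that by blast
  have "g \<in> carrier G \<and> (\<forall>x\<in>generate G R. g \<otimes> x \<otimes> inv g \<in> generate G R)" using g
  proof (induction rule: generate.induct)
    case one
    then show ?case by simp
  next
    case (incl h)
    then show ?case by (rule base)
  next
    case (inv h)
    then show ?case using base[OF inv] Q(2)[OF inv] by simp
  next
    case (eng h1 h2)
    have "(h1 \<otimes> h2) \<otimes> x \<otimes> inv (h1 \<otimes> h2) = h1 \<otimes> (h2 \<otimes> x \<otimes> inv h2) \<otimes> inv h1"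
      if "x \<in> generate G R" for x
      using that eng by (simp add: m_assoc inv_mult_group)
    then show ?case using eng by auto
  qed
  then show ?thesis ..
qed

text \<open>The identities \<open>[xy, q] = x [y, q] x^-1 [x, q]\<close> and
  \<open>[x, yz] = [x, y] y [x, z] y^-1\<close> reduce the claim to commutators of generators, since
  \<open>N\<close> is normalised by the group generated by \<open>Q\<close>.\<close>

lemma comm_generate:
  assumes Q: "Q \<subseteq> carrier G" "R \<subseteq> generate G Q" and N: "subgroup N G"
    and norm: "\<And>g x. g \<in> generate G Q \<Longrightarrow> x \<in> N \<Longrightarrow> g \<otimes> x \<otimes> inv g \<in> N"
    and gens: "\<And>r q. r \<in> R \<Longrightarrow> q \<in> Q \<Longrightarrow> comm r q \<in> N"
    and x: "x \<in> generate G R" and y: "y \<in> generate G Q"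
  shows "comm x y \<in> N"
proof -
  interpret N: subgroup N G by (rule N)
  interpret H: subgroup "generate G Q" G using Q by (intro generate_is_subgroup)
  have fst: "x \<in> generate G Q \<and> (\<forall>q\<in>Q. comm x q \<in> N)" using x
  proof (induction rule: generate.induct)
    case one
    then show ?case using Q by auto
  next
    case (incl h)
    then show ?case using gens Q by auto
  next
    case (inv h)
    have h: "h \<in> generate G Q" using inv Q by auto
    have "comm (inv h) q = inv h \<otimes> inv (comm h q) \<otimes> inv (inv h)" if "q \<in> Q" for q
      using that h Q by (auto simp: comm_def inv_mult_group m_assoc)
    then show ?case using h gens inv norm[of "inv h"] by auto
  next
    case (eng h1 h2)
    have "comm (h1 \<otimes> h2) q = (h1 \<otimes> comm h2 q \<otimes> inv h1) \<otimes> comm h1 q" if "q \<in> Q" for q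
    proof -
      have "q \<in> carrier G" using that Q by auto
      then show ?thesis using eng by (simp add: comm_def inv_mult_group m_assoc cancel_left)
    qed
    then show ?case using eng norm by auto
  qed
  have "y \<in> generate G Q \<and> comm x y \<in> N" using y
  proof (induction rule: generate.induct)
    case one
    then show ?case using fst by auto
  next
    case (incl h)
    then show ?case using fst by (auto intro: generate.incl)
  next
    case (inv h)
    then have h: "h \<in> generate G Q" by (auto intro: generate.incl)
    then have "comm x (inv h) = inv h \<otimes> inv (comm x h) \<otimes> inv (inv h)"
      using fst by (auto simp: comm_def inv_mult_group m_assoc cancel_left)
    then show ?case using h fst inv norm[of "inv h"] by auto
  next
    case (eng h1 h2)
    then have "comm x (h1 \<otimes> h2) = comm x h1 \<otimes> (h1 \<otimes> comm x h2 \<otimes> inv h1)"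
      using fst by (simp add: comm_def inv_mult_group m_assoc cancel_left)
    then show ?case using eng norm by auto
  qed
  then show ?thesis ..
qed

lemma lower_central_subset:
  assumes H: "subgroup H G" shows "lower_central (G\<lparr>carrier := H\<rparr>) j \<subseteq> H"
proof -
  interpret H: group "G\<lparr>carrier := H\<rparr>" by (rule subgroup_imp_group[OF H])
  show ?thesis
  proof (induction j)
    case (Suc j)
    have "subgroup (lower_central (G\<lparr>carrier := H\<rparr>) (Suc j)) (G\<lparr>carrier := H\<rparr>)"
      unfolding lower_central.simps commutator_subgroup_def
      by (rule H.generate_is_subgroup) (use Suc H.m_closed H.inv_closed in \<open>fastforce simp del: H.m_closed H.inv_closed\<close>)
    then show ?case using subgroup.subset by fastforce
  qed simp
qed

text \<open>By induction each term of the series is generated by commutators that lie in the next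
  member of \<open>F\<close>: a central filtration bounds the lower central series from
  above.\<close>

lemma lower_central_le:
  assumes H: "subgroup H G" and F0: "F 0 = H" and F: "\<And>j. subgroup (F j) G"
    and step: "\<And>j x y. x \<in> F j \<Longrightarrow> y \<in> H \<Longrightarrow> comm x y \<in> F (Suc j)"
  shows "lower_central (G\<lparr>carrier := H\<rparr>) j \<subseteq> F j"
proof (induction j)
  case (Suc j)
  let ?H = "G\<lparr>carrier := H\<rparr>"
  interpret H: group ?H by (rule subgroup_imp_group[OF H])
  interpret Fj: subgroup "F (Suc j)" G by (rule F)
  have L: "lower_central ?H j \<subseteq> H" by (rule lower_central_subset[OF H])
  let ?x0 = "\<Union>x\<in>lower_central ?H j. \<Union>y\<in>carrier ?H. {x \<otimes>\<^bsub>?H\<^esub> y \<otimes>\<^bsub>?H\<^esub> inv\<^bsub>?H\<^esub> x \<otimes>\<^bsub>?H\<^esub> inv\<^bsub>?H\<^esub> y}"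
  have "?x0 \<subseteq> F (Suc j)"
  proof
    fix z assume "z \<in> ?x0"
    then obtain x y where xy: "x \<in> lower_central ?H j" "y \<in> H"
      "z = x \<otimes> y \<otimes> inv\<^bsub>?H\<^esub> x \<otimes> inv\<^bsub>?H\<^esub> y" by auto
    then have "z = comm x y" using m_inv_consistent[OF H] L by (auto simp: comm_def)
    then show "z \<in> F (Suc j)" using step xy Suc by auto
  qed
  moreover have XH: "?x0 \<subseteq> H" using L H.m_closed H.inv_closed by fastforce
  ultimately have "generate G ?x0 \<subseteq> F (Suc j)" using generate_subgroup_incl[OF _ F] by blast
  then show ?case using generate_consistent[OF XH H] by (simp add: commutator_subgroup_def)
qed (simp add: F0)

lemma comm_in_lower_central:
  assumes H: "subgroup H G" and "x \<in> lower_central (G\<lparr>carrier := H\<rparr>) j" "y \<in> H"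
  shows "comm x y \<in> lower_central (G\<lparr>carrier := H\<rparr>) (Suc j)"
proof -
  have "x \<in> H" using lower_central_subset[OF H] assms by auto
  then have "comm x y = x \<otimes> y \<otimes> inv\<^bsub>G\<lparr>carrier := H\<rparr>\<^esub> x \<otimes> inv\<^bsub>G\<lparr>carrier := H\<rparr>\<^esub> y"
    using m_inv_consistent[OF H] assms by (simp add: comm_def)
  then show ?thesis unfolding lower_central.simps commutator_subgroup_def
    using assms by (intro generate.incl) auto
qed

end

section \<open>Commutators of root elements along a path\<close>

context blueprint_group
begin

abbreviation gm (infixl "\<cdot>" 70) where "x \<cdot> y \<equiv> x \<otimes>\<^bsub>G\<^esub> y"

abbreviation r :: "'a list \<Rightarrow> 'g" where "r \<equiv> root_elt G n u"

lemma root_closed: "set g \<subseteq> S \<Longrightarrow> r g \<in> carrier G"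
  by (induction g rule: root_word.induct) (auto simp: n_closed u_closed)

lemma cancel_n: "s \<in> S \<Longrightarrow> x \<in> carrier G \<Longrightarrow> n s \<cdot> (n s \<cdot> x) = x"
  by (simp add: n_closed n_sq flip: G.m_assoc)

lemma root_sq: "set g \<subseteq> S \<Longrightarrow> r g \<cdot> r g = \<one>\<^bsub>G\<^esub>"
proof (induction g rule: root_word.induct)
  case (3 s t g)
  then have m: "n s \<in> carrier G" "r (t # g) \<in> carrier G" "s \<in> S" using root_closed n_closed by auto
  have "r (s # t # g) \<cdot> r (s # t # g) = n s \<cdot> (r (t # g) \<cdot> (n s \<cdot> (n s \<cdot> (r (t # g) \<cdot> n s))))"
    using m by (simp add: G.m_assoc)
  also have "\<dots> = n s \<cdot> ((r (t # g) \<cdot> r (t # g)) \<cdot> n s)"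
    using m cancel_n by (simp add: G.m_assoc)
  also have "\<dots> = \<one>\<^bsub>G\<^esub>" using 3 m n_sq by simp
  finally show ?case .
qed (auto simp: u_sq)

lemma root_inv: "set g \<subseteq> S \<Longrightarrow> inv\<^bsub>G\<^esub> (r g) = r g"
  using root_sq root_closed by (intro G.inv_equality) auto

lemma root_neq_one: "set g \<subseteq> S \<Longrightarrow> g \<noteq> [] \<Longrightarrow> r g \<noteq> \<one>\<^bsub>G\<^esub>"
proof (induction g rule: root_word.induct)
  case (3 s t g)
  then have m: "n s \<in> carrier G" "r (t # g) \<in> carrier G" "s \<in> S" using root_closed n_closed by auto
  have "n s \<cdot> r (s # t # g) \<cdot> n s = r (t # g)"
    using m cancel_n n_sq by (simp add: G.m_assoc)
  then show ?case using 3 m n_sq by auto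
qed (auto simp: u_nontrivial)

lemma valid_set: "valid g \<Longrightarrow> set g \<subseteq> S"
  by (simp add: valid_def)

text \<open>Root elements are involutions, so the commutator is the product given by
  \<open>conj_word\<close> times \<open>?g\<close>. If there is a second factor, the two copies of
  \<open>?g\<close> around it cancel, because the shortened word ends in \<open>c\<close> and its
  root element commutes with \<open>?g\<close>.\<close>

lemma comm_conj_word:
  assumes v: "valid (x @ [d] @ y)" and y: "y \<noteq> []"
  shows "conj_word d y = [y] \<Longrightarrow> G.comm (r (x @ [d])) (r (x @ [d] @ y)) = \<one>\<^bsub>G\<^esub>"
    and "conj_word d y = [y, y'] \<Longrightarrow> G.comm (r (x @ [d])) (r (x @ [d] @ y)) = r (x @ [d] @ y')"
proof -
  let ?p = "r (x @ [d])" and ?g = "r (x @ [d] @ y)"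
  have S: "set (x @ [d]) \<subseteq> S" "set (x @ [d] @ y) \<subseteq> S" using v by (auto simp: valid_def)
  have c: "?p \<in> carrier G" "?g \<in> carrier G" using S root_closed by blast+
  have eq: "G.comm ?p ?g = foldr (\<cdot>) (map (\<lambda>z. r (x @ [d] @ z)) (conj_word d y)) \<one>\<^bsub>G\<^esub> \<cdot> ?g"
    using rel[OF v y] root_inv[OF S(1)] root_inv[OF S(2)] by (simp add: G.comm_def)
  show one: "conj_word d y = [y] \<Longrightarrow> G.comm ?p ?g = \<one>\<^bsub>G\<^esub>"
    using eq c root_sq[OF S(2)] by simp
  assume s: "conj_word d y = [y, y']"
  then have y': "prefix y' y" "y' \<noteq> []" using conj_word_prefix[of y' d y] conj_word_nonempty[of y' d y] y by auto
  then have S': "set (x @ [d] @ y') \<subseteq> S" using S by (auto simp: prefix_def)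
  then have c': "r (x @ [d] @ y') \<in> carrier G" using root_closed by blast
  have "r (x @ [d] @ y') \<cdot> ?g = ?g \<cdot> r (x @ [d] @ y')"
  proof (cases "y' = y")
    case False
    then obtain w where w: "y = y' @ w" "w \<noteq> []" using y' by (auto simp: prefix_def)
    have l: "last y' = c" using conj_word_last[of y' d y] s False by auto
    then have yl: "y' = butlast y' @ [c]" using y' by (metis append_butlast_last_id)
    then obtain x0 where x0: "x0 @ [c] = x @ [d] @ y'" "x0 @ [c] @ w = x @ [d] @ y"
      using w by (metis append_assoc)
    have "valid (x0 @ [c] @ w)" unfolding x0(2) by (rule v)
    moreover have "r (x0 @ [c] @ w) \<in> carrier G" unfolding x0(2) by (rule c(2))
    ultimately have "r (x0 @ [c]) \<cdot> r (x0 @ [c] @ w) \<cdot> r (x0 @ [c]) = r (x0 @ [c] @ w)"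
      using rel[of x0 c w] w(2) abc by (simp add: conj_word_not_a)
    then have "r (x @ [d] @ y') \<cdot> ?g \<cdot> r (x @ [d] @ y') = ?g" unfolding x0 .
    then have "r (x @ [d] @ y') \<cdot> ?g \<cdot> r (x @ [d] @ y') \<cdot> r (x @ [d] @ y') = ?g \<cdot> r (x @ [d] @ y')" by simp
    then show ?thesis using c c' root_sq[OF S'] by (simp add: G.m_assoc)
  qed simp
  then have "?g \<cdot> r (x @ [d] @ y') \<cdot> ?g = r (x @ [d] @ y')"
    using c c' root_sq[OF S(2)] by (metis G.m_assoc G.r_one)
  then show "G.comm ?p ?g = r (x @ [d] @ y')" using eq s c c' by (simp add: G.m_assoc)
qed

text \<open>When \<open>g\<close> is moved by some \<open>a\<close>, the part of \<open>g\<close> after its last \<open>a\<close> is \<open>b (c b)\<^sup>i c\<close>; its length \<open>2i + 2\<close>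
  determines the index \<open>i\<close>.\<close>

definition weight :: "'a list \<Rightarrow> nat" where
  "weight g = card {j \<in> L. bit ((length (takeWhile (\<lambda>s. s \<noteq> a) (rev g)) - 2) div 2) j}"

lemma takeWhile_block: "takeWhile (\<lambda>s. s \<noteq> a) (rev (x @ [a] @ block k i)) = rev (b # tail i)"
proof (induction k arbitrary: x)
  case 0
  have "\<forall>s\<in>set (rev (b # tail i)). s \<noteq> a" using set_tail[of i] abc by auto
  then have "takeWhile (\<lambda>s. s \<noteq> a) (rev (b # tail i) @ a # rev x) = rev (b # tail i)"
    by (subst takeWhile_append2) auto
  then show ?case by simp
next
  case (Suc k)
  show ?case using Suc[of "x @ [a, b]"] by simp
qed

lemma finite_bits: "finite {j. bit (i::nat) j}"
proof (rule finite_subset)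
  show "{j. bit i j} \<subseteq> {..i}"
  proof
    fix j assume "j \<in> {j. bit i j}"
    then have "i div 2 ^ j \<noteq> 0" by (auto simp: bit_iff_odd intro!: Nat.gr0I)
    then have "2 ^ j \<le> i" by (simp add: div_eq_0_iff)
    then show "j \<in> {..i}" using less_exp[of j] by (simp only: atMost_iff)
  qed
qed simp

lemma weight_block: "weight (x @ [a] @ block k i) = card {j \<in> L. bit i j}"
proof -
  have "length (tail i) = 2 * i + 1" by (simp add: tail_def length_concat sum_list_replicate)
  then show ?thesis using takeWhile_block[of x k i] by (simp add: weight_def)
qed

lemma weight_less: "k \<in> L \<Longrightarrow> bit i k \<Longrightarrow> weight (x @ [a] @ block k (unset_bit k i)) < weight (x @ [a] @ block k i)"
  unfolding weight_block
  by (intro psubset_card_mono finite_subset[OF _ finite_bits[of i]]) (auto simp: bit_unset_bit_iff)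

text \<open>If \<open>z\<close> is the normal form of \<open>w\<close>, these words name the roots
  that contain \<open>1\<close> but not \<open>w\<close>, so they index the generators of
  \<open>U_w\<close>.\<close>

definition segments :: "'a list \<Rightarrow> 'a list set" where
  "segments z = {g. g \<noteq> [] \<and> prefix g z}"

text \<open>A nontrivial commutator clears a bit in \<open>L\<close>, which lowers the weight. Its
  word is a block preceded by some path, hence ends in \<open>c\<close>, whereas only words ending
  in \<open>a\<close> move longer ones. These two facts drive the filtration of the chain
  group.\<close>

lemma comm_cases:
  assumes z: "valid z" and p: "p \<in> segments z" and g: "g \<in> segments z" and pg: "prefix p g"
  obtains "G.comm (r p) (r g) = \<one>\<^bsub>G\<^esub>"
  | h where "last p = a" "last g = c" "h \<in> segments z" "last h = c" "weight h < weight g" "G.comm (r p) (r g) = r h"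
proof (cases "p = g")
  case True
  then have "set g \<subseteq> S" using z g by (auto simp: segments_def valid_def prefix_def)
  then show ?thesis using that(1) True root_inv root_sq root_closed[of g] by (simp add: G.comm_def G.m_assoc)
next
  case False
  then obtain y where y: "g = p @ y" "y \<noteq> []" using pg by (auto simp: prefix_def)
  define x d where "x = butlast p" "d = last p"
  then have pd: "p = x @ [d]" "g = x @ [d] @ y" using p y by (auto simp: segments_def)
  have v: "valid (x @ [d] @ y)" using valid_prefix[OF z, of g] g pd by (simp add: segments_def)
  show ?thesis
  proof (cases rule: conj_word_cases[of d y])
    case 1
    then show ?thesis using that(1) comm_conj_word(1)[OF v y(2)] pd by simp
  next
    case (2 k i)
    let ?h = "x @ [d] @ block k (unset_bit k i)"
    have "prefix ?h g" using conj_word_prefix[of "block k (unset_bit k i)" d y] 2 pd by simp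
    then have "?h \<in> segments z" using g by (auto simp: segments_def intro: prefix_order.trans)
    moreover have "G.comm (r p) (r g) = r ?h" using comm_conj_word(2)[OF v y(2) 2(5)] pd by simp
    moreover have "weight ?h < weight g" using weight_less[OF 2(2,3), of x] 2 pd by simp
    moreover have "last p = a" "last g = c" "last ?h = c" using pd 2 by auto
    ultimately show ?thesis using that(2) by blast
  qed
qed

section \<open>Upper bound for the nilpotency class along a path\<close>

abbreviation chain_group :: "'a list \<Rightarrow> 'g set" where
  "chain_group z \<equiv> generate G (r ` segments z)"

lemma segments_set: "valid z \<Longrightarrow> g \<in> segments z \<Longrightarrow> set g \<subseteq> S"
  by (auto simp: segments_def valid_def prefix_def)

lemma chain_subgroup: "valid z \<Longrightarrow> subgroup (chain_group z) G"
  by (intro G.generate_is_subgroup) (use root_closed segments_set in blast)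

text \<open>The chain group is filtered by weight: commutators lower the weight, so from step
  \<open>1\<close> on it is at most \<open>K - j\<close> at step \<open>j\<close>, and no word is
  left at step \<open>Suc K\<close>.\<close>

lemma chain_lower_central:
  assumes z: "valid z" and K: "\<And>g. g \<in> segments z \<Longrightarrow> weight g \<le> K"
  shows "lower_central (G\<lparr>carrier := chain_group z\<rparr>) (Suc K) = {\<one>\<^bsub>G\<^esub>}"
proof -
  \<comment> \<open>Only layer \<open>0\<close> may contain words ending in \<open>a\<close>, the
    ones that move others. Layer \<open>Suc K\<close> is empty because
    \<open>weight g + Suc K \<le> K\<close> is impossible.\<close>
  define Q where "Q j = (if j = 0 then segments z else {g \<in> segments z. last g = c \<and> weight g + j \<le> K})" for j
  let ?F = "\<lambda>j. generate G (r ` Q j)"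
  have Qs: "Q j \<subseteq> segments z" for j by (auto simp: Q_def)
  have Qc: "r ` Q j \<subseteq> carrier G" for j using Qs segments_set[OF z] root_closed by blast
  have inF: "r h \<in> ?F j" if "h \<in> Q j" for h j using that by (auto intro: generate.incl)
  have one: "\<one>\<^bsub>G\<^esub> \<in> ?F j" for j by (rule generate.one)
  have cinv: "G.comm x y \<in> ?F j \<Longrightarrow> x \<in> carrier G \<Longrightarrow> y \<in> carrier G \<Longrightarrow> G.comm y x \<in> ?F j" for x y j
    using G.inv_comm[of x y] subgroup.m_inv_closed[OF G.generate_is_subgroup[OF Qc]] by metis
  have rc: "r g \<in> carrier G" if "g \<in> segments z" for g using that segments_set[OF z] root_closed by blast
  have step: "G.comm (r g) (r p) \<in> ?F (Suc j)" if g: "g \<in> Q j" and p: "p \<in> segments z" for g p j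
  proof -
    have gs: "g \<in> segments z" using g Qs by blast
    consider "prefix p g" | "prefix g p" using gs p by (auto simp: segments_def dest: prefix_same_cases)
    then show ?thesis
    proof cases
      case 1
      have "G.comm (r p) (r g) \<in> ?F (Suc j)"
      proof (rule comm_cases[OF z p gs 1])
        fix h assume h: "last g = c" "h \<in> segments z" "last h = c" "weight h < weight g" "G.comm (r p) (r g) = r h"
        then have "h \<in> Q (Suc j)" using g K[OF gs] by (auto simp: Q_def split: if_splits)
        then show ?thesis using inF h by simp
      qed (use one in simp)
      then show ?thesis using cinv rc p gs by blast
    next
      case 2
      show ?thesis
      proof (rule comm_cases[OF z gs p 2])
        fix h assume h: "last g = a" "last p = c" "h \<in> segments z" "last h = c" "weight h < weight p"
          "G.comm (r g) (r p) = r h"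
        \<comment> \<open>A word moving a longer one ends in \<open>a\<close> and hence lies in
          layer \<open>0\<close>; the bound \<open>K\<close> on the weight of \<open>p\<close> then
          puts \<open>h\<close> into layer \<open>1\<close>.\<close>
        then have "j = 0" using g abc by (auto simp: Q_def split: if_splits)
        then have "h \<in> Q (Suc j)" using h K[OF p] by (auto simp: Q_def)
        then show ?thesis using inF h by simp
      qed (use one in simp)
    qed
  qed
  have norm: "\<forall>x\<in>?F j. y \<cdot> x \<cdot> inv\<^bsub>G\<^esub> y \<in> ?F j" if y: "y \<in> chain_group z" for j y
  proof (rule G.generate_normalizes[OF Qc _ _ _ y])
    show "r ` segments z \<subseteq> carrier G" using rc by blast
    show "inv\<^bsub>G\<^esub> q = q" if "q \<in> r ` segments z" for q using that root_inv segments_set[OF z] by blast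
    fix q x assume q: "q \<in> r ` segments z" and x: "x \<in> r ` Q j"
    then obtain p g where pg: "q = r p" "p \<in> segments z" "x = r g" "g \<in> Q j" by auto
    have c: "q \<in> carrier G" "x \<in> carrier G" using pg rc Qs by blast+
    have "G.comm x q \<in> ?F (Suc j)" using step pg by simp
    moreover have "r ` Q (Suc j) \<subseteq> r ` Q j" by (auto simp: Q_def split: if_splits)
    ultimately have "G.comm x q \<in> ?F j" using G.mono_generate by blast
    then have "G.comm q x \<in> ?F j" using cinv c by blast
    then have "G.comm q x \<cdot> x \<in> ?F j" using pg inF by (auto intro: generate.eng)
    moreover have "G.comm q x \<cdot> x = q \<cdot> x \<cdot> inv\<^bsub>G\<^esub> q" using c by (simp add: G.comm_def G.m_assoc)
    ultimately show "q \<cdot> x \<cdot> inv\<^bsub>G\<^esub> q \<in> ?F j" by simp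
  qed
  have "lower_central (G\<lparr>carrier := chain_group z\<rparr>) (Suc K) \<subseteq> ?F (Suc K)"
  proof (rule G.lower_central_le[OF chain_subgroup[OF z]])
    show "?F 0 = chain_group z" by (simp add: Q_def)
    show "subgroup (?F j) G" for j by (rule G.generate_is_subgroup[OF Qc])
    fix j x y assume xy: "x \<in> ?F j" "y \<in> chain_group z"
    show "G.comm x y \<in> ?F (Suc j)"
    proof (rule G.comm_generate[OF _ _ G.generate_is_subgroup[OF Qc] _ _ xy])
      show "r ` segments z \<subseteq> carrier G" using rc by blast
      show "r ` Q j \<subseteq> chain_group z" using Qs by (auto intro: generate.incl)
      show "g \<cdot> x \<cdot> inv\<^bsub>G\<^esub> g \<in> ?F (Suc j)" if "g \<in> chain_group z" "x \<in> ?F (Suc j)" for g x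
        using norm that by blast
      show "G.comm x q \<in> ?F (Suc j)" if "x \<in> r ` Q j" "q \<in> r ` segments z" for x q
        using that step by blast
    qed
  qed
  also have "Q (Suc K) = {}" by (auto simp: Q_def)
  finally have "lower_central (G\<lparr>carrier := chain_group z\<rparr>) (Suc K) \<subseteq> {\<one>\<^bsub>G\<^esub>}"
    by (simp add: G.generate_empty)
  moreover have "\<one>\<^bsub>G\<^esub> \<in> lower_central (G\<lparr>carrier := chain_group z\<rparr>) (Suc K)"
    using generate.one[of "G\<lparr>carrier := chain_group z\<rparr>"] by (simp add: commutator_subgroup_def)
  ultimately show ?thesis by blast
qed

section \<open>Paths on which the bound is attained\<close>

definition long_chain :: "nat \<Rightarrow> nat \<Rightarrow> 'a list" where
  "long_chain N i = concat (replicate N [a, b]) @ tail i"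

lemma long_chain_Suc: "long_chain (Suc k) i = a # block k i"
  by (induction k) (simp_all add: long_chain_def)

text \<open>For every \<open>k < N\<close> the word \<open>(a b)^N (c b)^i c\<close> has a letter
  \<open>a\<close> followed by \<open>block k i\<close>, so one path offers a conjugation for each
  bit below \<open>N\<close>. The position \<open>x\<close> is independent of \<open>i\<close> and
  so survives the clearing of bits.\<close>

lemma long_chain_split: "k < N \<Longrightarrow> \<exists>x. \<forall>i. long_chain N i = x @ [a] @ block k i"
proof (induction N)
  case (Suc N)
  show ?case
  proof (cases "k = N")
    case True
    then show ?thesis by (intro exI[of _ "[]"]) (simp add: long_chain_Suc)
  next
    case False
    then obtain x where "\<forall>i. long_chain N i = x @ [a] @ block k i" using Suc by auto
    then show ?thesis by (intro exI[of _ "[a, b] @ x"]) (simp add: long_chain_def)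
  qed
qed simp

lemma long_chain_valid: "valid (long_chain N i)"
proof -
  have "distinct_adj (tail i)"
  proof (induction i)
    case (Suc i)
    then show ?case using hd_tail[of i] abc by (auto simp: tail_Suc distinct_adj_Cons)
  qed (simp add: tail_0)
  then have "distinct_adj (long_chain N i) \<and> hd (long_chain N i) \<noteq> b"
  proof (induction N)
    case 0
    then show ?case using hd_tail[of i] abc by (auto simp: long_chain_def)
  next
    case (Suc N)
    then show ?case using abc by (auto simp: long_chain_def distinct_adj_Cons)
  qed
  moreover have "set (long_chain N i) \<subseteq> S" using set_tail[of i] abc by (auto simp: long_chain_def)
  ultimately show ?thesis by (auto simp: valid_def long_chain_def tail_def)
qed

primrec clear_bits :: "nat \<Rightarrow> nat \<Rightarrow> nat" where
  "clear_bits N 0 = mask N"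
| "clear_bits N (Suc j) = unset_bit j (clear_bits N j)"

lemma bit_clear_bits: "bit (clear_bits N j) k \<longleftrightarrow> j \<le> k \<and> k < N"
  by (induction j) (auto simp: bit_unset_bit_iff bit_mask_iff)

text \<open>Successive commutators with root elements of letters \<open>a\<close> clear one bit at a
  time, starting from \<open>N\<close> ones. After \<open>j\<close> steps the result is still a root
  element, hence nontrivial.\<close>

lemma long_chain_lower_central:
  assumes L: "{..<N} \<subseteq> L" and j: "j \<le> N"
  shows "lower_central (G\<lparr>carrier := chain_group (long_chain N (mask N))\<rparr>) j \<noteq> {\<one>\<^bsub>G\<^esub>}"
proof -
  let ?z = "long_chain N (mask N)"
  have v: "valid ?z" by (rule long_chain_valid)
  have "r (long_chain N (clear_bits N j)) \<in> lower_central (G\<lparr>carrier := chain_group ?z\<rparr>) j"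
    using j
  proof (induction j)
    case 0
    have "?z \<in> segments ?z" using v by (auto simp: segments_def valid_def)
    then show ?case by (auto intro: generate.incl)
  next
    case (Suc j)
    let ?i = "clear_bits N j" and ?i' = "clear_bits N (Suc j)"
    obtain x where x: "\<And>i. long_chain N i = x @ [a] @ block j i" using long_chain_split[of j N] Suc.prems by auto
    have bit: "bit ?i j" "j \<in> L" using Suc.prems L by (auto simp: bit_clear_bits)
    then have sg: "conj_word a (block j ?i) = [block j ?i, block j ?i']" by (simp add: conj_word_block)
    have "valid (x @ [a] @ block j ?i)" using long_chain_valid[of N ?i] x by simp
    then have "G.comm (r (x @ [a])) (r (x @ [a] @ block j ?i)) = r (long_chain N ?i')"
      using comm_conj_word(2)[OF _ _ sg] x by simp
    moreover have c: "r (x @ [a]) \<in> carrier G" "r (long_chain N ?i) \<in> carrier G"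
      "set (long_chain N ?i') \<subseteq> S"
      using long_chain_valid[of N ?i] long_chain_valid[of N ?i'] x root_closed by (auto simp: valid_def)
    \<comment> \<open>Exchanging the arguments inverts the commutator, and its value is an
      involution.\<close>
    ultimately have "G.comm (r (long_chain N ?i)) (r (x @ [a])) = r (long_chain N ?i')"
      using G.inv_comm[of "r (x @ [a])" "r (long_chain N ?i)"] root_inv[of "long_chain N ?i'"] x by simp
    moreover have "x @ [a] \<in> segments ?z" using x[of "mask N"] by (auto simp: segments_def)
    then have "r (x @ [a]) \<in> chain_group ?z" by (auto intro: generate.incl)
    ultimately show ?case
      using G.comm_in_lower_central[OF chain_subgroup[OF v], of "r (long_chain N ?i)" j "r (x @ [a])"]
        Suc by (simp del: lower_central.simps)
  qed
  moreover have "r (long_chain N (clear_bits N j)) \<noteq> \<one>\<^bsub>G\<^esub>"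
    using long_chain_valid[of N "clear_bits N j"] root_neq_one by (auto simp: valid_def)
  ultimately show ?thesis by auto
qed

end


section \<open>Roots of a universal Coxeter system\<close>

context universal_coxeter_system
begin

section \<open>Normal forms in a free product of groups of order two\<close>

lemma S_carrier: "s \<in> S \<Longrightarrow> s \<in> carrier W"
  using gens_subset by auto

lemma S_square: "s \<in> S \<Longrightarrow> s \<otimes> s = \<one>"
  using gens_ord[of s] S_carrier[of s] pow_ord_eq_1[of s] by (simp add: numeral_2_eq_2)

lemma S_inv: "s \<in> S \<Longrightarrow> inv s = s"
  using S_square S_carrier by (intro inv_equality) auto

lemma prefix_single: "prefix [s] xs \<longleftrightarrow> xs \<noteq> [] \<and> hd xs = s"
  by (cases xs) auto

text \<open>Left multiplication by \<open>s\<close> on reduced words, where cancelling an equal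
  first letter is the only possible reduction.\<close>

definition push :: "'a \<Rightarrow> 'a list \<Rightarrow> 'a list" where
  "push s w = (if w \<noteq> [] \<and> hd w = s then tl w else s # w)"

definition reduced :: "'a list \<Rightarrow> bool" where
  "reduced w \<longleftrightarrow> w \<in> lists S \<and> distinct_adj w"

definition reduce :: "'a list \<Rightarrow> 'a list \<Rightarrow> 'a list" where
  "reduce ws v = foldr push ws v"

lemma reduced_push: "reduced w \<Longrightarrow> s \<in> S \<Longrightarrow> reduced (push s w)"
  by (cases w) (auto simp: reduced_def push_def distinct_adj_Cons)

lemma push_push: "reduced w \<Longrightarrow> push s (push s w) = w"
  by (cases w) (auto simp: reduced_def push_def distinct_adj_Cons)

lemma reduced_reduce: "ws \<in> lists S \<Longrightarrow> reduced v \<Longrightarrow> reduced (reduce ws v)"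
  by (induction ws) (auto simp: reduce_def reduced_push)

lemma reduce_reduced: "reduced (w @ v) \<Longrightarrow> reduce w v = w @ v"
  by (induction w) (auto simp: reduce_def push_def reduced_def distinct_adj_Cons)

lemma word_prod_simps [simp]: "word_prod W [] = \<one>" "word_prod W (s # ws) = s \<otimes> word_prod W ws"
  by (simp_all add: word_prod_def)

lemma word_prod_closed [simp]: "ws \<in> lists S \<Longrightarrow> word_prod W ws \<in> carrier W"
  by (induction ws) (auto simp: S_carrier)

lemma word_prod_append: "us \<in> lists S \<Longrightarrow> vs \<in> lists S \<Longrightarrow>
    word_prod W (us @ vs) = word_prod W us \<otimes> word_prod W vs"
  by (induction us) (auto simp: S_carrier m_assoc)

lemma word_prod_push: "s \<in> S \<Longrightarrow> w \<in> lists S \<Longrightarrow> word_prod W (push s w) = s \<otimes> word_prod W w"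
  by (cases w) (auto simp: push_def S_carrier S_square simp flip: m_assoc)

lemma word_prod_reduce: "ws \<in> lists S \<Longrightarrow> word_prod W (reduce ws []) = word_prod W ws"
  by (induction ws) (use reduced_reduce[of _ "[]"] word_prod_push in \<open>auto simp: reduce_def reduced_def\<close>)

text \<open>Van der Waerden's argument: generators act on reduced words by the involutions
  \<open>push\<close>, and for \<open>s \<noteq> t\<close> the relator is empty because
  \<open>ord (s \<otimes> t) = 0\<close>. Membership in \<open>lists S\<close> is carried along
  since \<open>coxeter_cong\<close> also relates words with letters outside
  \<open>S\<close>.\<close>

lemma coxeter_cong_reduce_eq:
  assumes "coxeter_cong W S us vs"
  shows "(us \<in> lists S \<longleftrightarrow> vs \<in> lists S) \<and> (us \<in> lists S \<longrightarrow> (\<forall>v. reduced v \<longrightarrow> reduce us v = reduce vs v))"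
  using assms
proof (induction rule: coxeter_cong.induct)
  case (append u v x y)
  then show ?case using reduced_reduce by (auto simp: reduce_def)
next
  case (relator s t)
  show ?case
  proof (cases "s = t")
    case True
    then have "ord (s \<otimes> t) = 1" using S_square relator ord_id by simp
    then show ?thesis using True relator push_push by (auto simp: reduce_def)
  next
    case False
    then show ?thesis using ord_infinite relator by simp
  qed
qed auto

lemma word_prod_inj:
  assumes "reduced u" "reduced v" "word_prod W u = word_prod W v" shows "u = v"
proof -
  have "coxeter_cong W S u v" using assms presentation by (simp add: reduced_def)
  moreover have "reduced []" by (simp add: reduced_def)
  ultimately have "reduce u [] = reduce v []"
    using coxeter_cong_reduce_eq assms(1) unfolding reduced_def by blast
  then show ?thesis using reduce_reduced[of u "[]"] reduce_reduced[of v "[]"] assms by simp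
qed

lemma word_exists: "w \<in> carrier W \<Longrightarrow> \<exists>ws. reduced ws \<and> word_prod W ws = w"
proof -
  assume "w \<in> carrier W"
  then have "w \<in> generate W S" using gens_generate by simp
  then have "\<exists>ws\<in>lists S. word_prod W ws = w"
  proof (induction rule: generate.induct)
    case one
    then show ?case by (intro bexI[of _ "[]"]) auto
  next
    case (incl h)
    then show ?case by (intro bexI[of _ "[h]"]) (auto simp: S_carrier)
  next
    case (inv h)
    then show ?case by (intro bexI[of _ "[h]"]) (auto simp: S_carrier S_inv)
  next
    case (eng h1 h2)
    then show ?case using word_prod_append by (metis append_in_lists_conv)
  qed
  then show ?thesis using word_prod_reduce reduced_reduce[of _ "[]"] by (auto simp: reduced_def)
qed

definition nf :: "'a \<Rightarrow> 'a list" where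
  "nf w = (THE ws. reduced ws \<and> word_prod W ws = w)"

lemma nf_word_prod [simp]: "reduced ws \<Longrightarrow> nf (word_prod W ws) = ws"
  unfolding nf_def using word_prod_inj by blast

lemma nf:
  assumes "w \<in> carrier W"
  shows reduced_nf: "reduced (nf w)" and word_prod_nf: "word_prod W (nf w) = w"
  using word_exists[OF assms] by auto

lemma reducedD [simp]: "reduced w \<Longrightarrow> w \<in> lists S"
  by (simp add: reduced_def)

lemma nf_word: "ws \<in> lists S \<Longrightarrow> nf (word_prod W ws) = reduce ws []"
  using word_prod_reduce[of ws] reduced_reduce[of ws "[]"] nf_word_prod[of "reduce ws []"]
  by (simp add: reduced_def)

lemma nf_mult: "s \<in> S \<Longrightarrow> w \<in> carrier W \<Longrightarrow> nf (s \<otimes> w) = push s (nf w)"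
  using nf_word_prod[of "push s (nf w)"] word_prod_push[of s "nf w"] reduced_push nf by auto

lemma length_reduce: "length (reduce ws []) \<le> length ws"
  by (induction ws) (auto simp: reduce_def push_def)

lemma cox_length_nf: "w \<in> carrier W \<Longrightarrow> cox_length W S w = length (nf w)"
  unfolding cox_length_def
proof (rule Least_equality)
  fix k assume "\<exists>ws\<in>lists S. length ws = k \<and> word_prod W ws = w"
  then show "length (nf w) \<le> k" using nf_word length_reduce by metis
qed (rule bexI[of _ "nf w"], use nf[of w] in simp_all)

lemma simple_root_iff:
  assumes "s \<in> S"
  shows "w \<in> simple_root W S s \<longleftrightarrow> w \<in> carrier W \<and> \<not> prefix [s] (nf w)"
  using assms
  by (cases "nf w") (auto simp: simple_root_def cox_length_nf nf_mult push_def S_carrier)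

section \<open>Roots as half-trees of the Cayley graph\<close>

definition root :: "'a \<Rightarrow> 'a \<Rightarrow> 'a set" where
  "root v s = v <# simple_root W S s"

lemma root_iff:
  assumes "v \<in> carrier W" "s \<in> S"
  shows "x \<in> root v s \<longleftrightarrow> x \<in> carrier W \<and> \<not> prefix [s] (nf (inv v \<otimes> x))"
proof -
  have "x \<in> root v s \<longleftrightarrow> x \<in> carrier W \<and> inv v \<otimes> x \<in> simple_root W S s"
    using assms unfolding root_def l_coset_def
    by (auto simp: simple_root_iff inv_solve_left' m_assoc[symmetric])
      (metis inv_closed l_inv l_one m_assoc m_closed simple_root_iff r_inv)
  then show ?thesis using assms by (auto simp: simple_root_iff)
qed

lemma roots_root: "roots W S = {root v s | v s. v \<in> carrier W \<and> s \<in> S}"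
  by (simp add: roots_def root_def)

lemma root_mult: "v \<in> carrier W \<Longrightarrow> w \<in> carrier W \<Longrightarrow> s \<in> S \<Longrightarrow> w <# root v s = root (w \<otimes> v) s"
  unfolding root_def by (rule lcos_m_assoc) (auto simp: simple_root_def)

lemma root_subset: "root v s \<subseteq> carrier W" if "v \<in> carrier W" "s \<in> S"
  using root_iff[OF that] by auto

text \<open>The opposite half-tree belongs to the same edge traversed backwards. In terms of words,
  \<open>push s\<close> toggles whether a reduced word starts with \<open>s\<close>.\<close>

lemma neg_root_root:
  assumes "v \<in> carrier W" "s \<in> S"
  shows "neg_root W (root v s) = root (v \<otimes> s) s"
proof -
  have "prefix [s] (nf (inv v \<otimes> x)) \<longleftrightarrow> \<not> prefix [s] (nf (inv (v \<otimes> s) \<otimes> x))"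
    if x: "x \<in> carrier W" for x
  proof -
    have "inv (v \<otimes> s) \<otimes> x = s \<otimes> (inv v \<otimes> x)"
      using assms x by (simp add: inv_mult_group S_inv S_carrier m_assoc)
    then have "nf (inv (v \<otimes> s) \<otimes> x) = push s (nf (inv v \<otimes> x))"
      using nf_mult assms x by simp
    moreover have "distinct_adj (nf (inv v \<otimes> x))" using reduced_nf assms x by (simp add: reduced_def)
    ultimately show ?thesis
      by (cases "nf (inv v \<otimes> x)") (auto simp: push_def distinct_adj_Cons prefix_single)
  qed
  then show ?thesis using assms S_carrier by (auto simp: neg_root_def root_iff)
qed

text \<open>Translation by the inverse of \<open>z\<close> carries the last edge of the path
  \<open>z @ [s]\<close> to the edge labelled \<open>s\<close> at \<open>1\<close>. This turns
  membership in a root into a condition on prefixes of normal forms.\<close>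

lemma reduce_rev: "reduced (z @ [s]) \<Longrightarrow> reduced x \<Longrightarrow>
    prefix [s] (reduce (rev z) x) \<longleftrightarrow> prefix (z @ [s]) x"
proof (induction z arbitrary: x)
  case Nil
  then show ?case by (simp add: reduce_def)
next
  case (Cons t z)
  have r: "reduced (z @ [s])" and t: "t \<in> S" "hd (z @ [s]) \<noteq> t"
    using Cons.prems(1) by (auto simp: reduced_def distinct_adj_Cons)
  have "reduce (rev (t # z)) x = reduce (rev z) (push t x)" by (simp add: reduce_def)
  also have "prefix [s] \<dots> \<longleftrightarrow> prefix (z @ [s]) (push t x)"
    using Cons.IH[OF r] reduced_push Cons.prems t by blast
  also have "\<dots> \<longleftrightarrow> prefix ((t # z) @ [s]) x"
    using Cons.prems(2) t by (cases x; cases z) (auto simp: push_def reduced_def distinct_adj_Cons neq_Nil_conv)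
  finally show ?case .
qed

text \<open>For a nonempty reduced word \<open>g\<close>, removing the last edge of its path leaves
  two half-trees; this is the one containing \<open>1\<close>, and \<open>neg g\<close> is the
  other.\<close>

definition pos :: "'a list \<Rightarrow> 'a set" where
  "pos g = {x \<in> carrier W. \<not> prefix g (nf x)}"

definition neg :: "'a list \<Rightarrow> 'a set" where
  "neg g = {x \<in> carrier W. prefix g (nf x)}"

lemma inv_word_prod: "ws \<in> lists S \<Longrightarrow> inv (word_prod W ws) = word_prod W (rev ws)"
proof (induction ws)
  case (Cons s ws)
  then have "rev ws \<in> lists S" by (auto simp: in_lists_conv_set)
  then show ?case using Cons word_prod_append[of "rev ws" "[s]"]
    by (auto simp: inv_mult_group S_inv S_carrier)
qed simp

lemma nf_mult_word: "ws \<in> lists S \<Longrightarrow> x \<in> carrier W \<Longrightarrow> nf (word_prod W ws \<otimes> x) = reduce ws (nf x)"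
proof (induction ws)
  case (Cons s ws)
  then show ?case using nf_mult[of s "word_prod W ws \<otimes> x"] by (simp add: m_assoc S_carrier reduce_def)
qed (simp add: reduce_def)

lemma root_pos:
  assumes "reduced (z @ [s])" shows "root (word_prod W z) s = pos (z @ [s])"
proof -
  have z: "z \<in> lists S" "s \<in> S" "rev z \<in> lists S" using assms by (auto simp: reduced_def in_lists_conv_set)
  show ?thesis
    using reduce_rev[OF assms reduced_nf]
    by (auto simp: pos_def root_iff[OF word_prod_closed[OF z(1)] z(2)] inv_word_prod[OF z(1)] nf_mult_word[OF z(3)])
qed

lemma root_neg:
  assumes "reduced (z @ [s])" shows "root (word_prod W (z @ [s])) s = neg (z @ [s])"
proof -
  have z: "z \<in> lists S" "s \<in> S" using assms by (auto simp: reduced_def)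
  then have "neg_root W (pos (z @ [s])) = root (word_prod W z \<otimes> s) s"
    using neg_root_root[of "word_prod W z" s] root_pos[OF assms] by simp
  moreover have "neg_root W (pos (z @ [s])) = neg (z @ [s])" by (auto simp: neg_root_def pos_def neg_def)
  ultimately show ?thesis using z word_prod_append[of z "[s]"] S_carrier by simp
qed

text \<open>The last letter of the normal form of \<open>v\<close> decides whether the edge from
  \<open>v\<close> to \<open>v \<otimes> s\<close> points towards \<open>1\<close> or away from
  it.\<close>

lemma root_cases [consumes 2]:
  assumes "v \<in> carrier W" "s \<in> S"
  obtains z where "v = word_prod W z" "reduced (z @ [s])" "root v s = pos (z @ [s])"
  | z where "v = word_prod W (z @ [s])" "reduced (z @ [s])" "root v s = neg (z @ [s])"
proof (cases "nf v \<noteq> [] \<and> last (nf v) = s")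
  case True
  then have "nf v = butlast (nf v) @ [s]" by (metis append_butlast_last_id)
  then show ?thesis using that(2) nf[OF assms(1)] root_neg by metis
next
  case False
  then have "reduced (nf v @ [s])" using nf(1)[OF assms(1)] assms by (auto simp: reduced_def distinct_adj_append_iff)
  then show ?thesis using that(1) nf[OF assms(1)] root_pos by metis
qed

lemma pos_root_iff: "\<alpha> \<in> pos_roots W S \<longleftrightarrow> (\<exists>g. g \<noteq> [] \<and> reduced g \<and> \<alpha> = pos g)"
proof
  assume "\<alpha> \<in> pos_roots W S"
  then obtain v s where v: "v \<in> carrier W" "s \<in> S" "\<alpha> = root v s" "\<one> \<in> \<alpha>"
    by (auto simp: pos_roots_def roots_root)
  have "nf \<one> = []" using nf_word_prod[of "[]"] by (simp add: reduced_def)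
  then have "\<one> \<notin> neg (z @ [s])" for z by (simp add: neg_def)
  then show "\<exists>g. g \<noteq> [] \<and> reduced g \<and> \<alpha> = pos g"
    using root_cases[OF v(1,2)] v(3,4) by (metis append_is_Nil_conv not_Cons_self2)
next
  assume "\<exists>g. g \<noteq> [] \<and> reduced g \<and> \<alpha> = pos g"
  then obtain g where g: "g \<noteq> []" "reduced g" "\<alpha> = pos g" by auto
  have "nf \<one> = []" using nf_word_prod[of "[]"] by (simp add: reduced_def)
  moreover have "\<alpha> \<in> roots W S"
  proof -
    have *: "reduced (butlast g @ [last g])" using g by simp
    then have "\<alpha> = root (word_prod W (butlast g)) (last g)" using root_pos[OF *] g by simp
    moreover have "butlast g \<in> lists S" "last g \<in> S" using * by (auto simp: reduced_def)
    ultimately show ?thesis unfolding roots_root using word_prod_closed by blast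
  qed
  ultimately show "\<alpha> \<in> pos_roots W S" using g by (auto simp: pos_roots_def pos_def)
qed

lemma pos_subset_iff: "reduced g \<Longrightarrow> reduced h \<Longrightarrow> pos g \<subseteq> pos h \<longleftrightarrow> prefix g h"
proof
  assume r: "reduced g" "reduced h" and "pos g \<subseteq> pos h"
  then have "word_prod W h \<notin> pos h" "word_prod W h \<in> carrier W" by (simp_all add: pos_def)
  then have "word_prod W h \<notin> pos g" using \<open>pos g \<subseteq> pos h\<close> by blast
  then show "prefix g h" using \<open>word_prod W h \<in> carrier W\<close> r by (simp add: pos_def)
qed (auto simp: pos_def intro: prefix_order.trans)

lemma pos_inj: "reduced g \<Longrightarrow> reduced h \<Longrightarrow> pos g = pos h \<Longrightarrow> g = h"
  using pos_subset_iff by (metis prefix_order.antisym order_refl)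

lemma pos_neq_neg: "g \<noteq> [] \<Longrightarrow> h \<noteq> [] \<Longrightarrow> pos g \<noteq> neg h"
proof -
  assume "g \<noteq> []" "h \<noteq> []"
  then have "\<one> \<in> pos g" "\<one> \<notin> neg h" using nf_word_prod[of "[]"] by (auto simp: pos_def neg_def reduced_def)
  then show ?thesis by auto
qed

text \<open>A half-tree determines its boundary edge and the direction of that edge. Root groups,
  which are indexed by subsets of \<open>W\<close>, can therefore be defined through the pair
  \<open>v\<close>, \<open>s\<close>.\<close>

lemma root_inj:
  assumes "v \<in> carrier W" "s \<in> S" "v' \<in> carrier W" "s' \<in> S" "root v s = root v' s'"
  shows "v = v' \<and> s = s'"
proof -
  have neg: "neg g = carrier W - pos g" for g by (auto simp: neg_def pos_def)
  have sub: "pos g \<subseteq> carrier W" for g by (auto simp: pos_def)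
  have ninj: "g = h" if "neg g = neg h" "reduced g" "reduced h" for g h
    using that neg sub pos_inj[of g h] by (metis double_diff order_refl)
  have pn: "pos (z @ [t]) \<noteq> neg (z' @ [t'])" for z z' t t' by (rule pos_neq_neg) auto
  from assms(1,2) show ?thesis
  proof (cases rule: root_cases)
    case 1: (1 z)
    from assms(3,4) show ?thesis
    proof (cases rule: root_cases)
      case (1 z')
      then show ?thesis using \<open>root v s = pos (z @ [s])\<close> \<open>reduced (z @ [s])\<close> \<open>v = _\<close>
        pos_inj[of "z @ [s]" "z' @ [s']"] assms(5) by auto
    next
      case (2 z')
      then show ?thesis using 1 pn assms(5) by metis
    qed
  next
    case 2: (2 z)
    from assms(3,4) show ?thesis
    proof (cases rule: root_cases)
      case (1 z')
      then show ?thesis using 2 pn assms(5) by metis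
    next
      case (2 z')
      then show ?thesis using \<open>root v s = neg (z @ [s])\<close> \<open>reduced (z @ [s])\<close> \<open>v = _\<close>
        ninj[of "z @ [s]" "z' @ [s']"] assms(5) by auto
    qed
  qed
qed

end


section \<open>The RGD-systems\<close>

locale universal_blueprint = universal_coxeter_system W S + blueprint_group S a b c L G n u
  for W (structure) and S a b c L and G :: "('g, 'h) monoid_scheme" (structure) and n u
begin

text \<open>As \<open>W\<close> is a free product of groups of order two, \<open>s \<mapsto> n\<^sub>s\<close> extends to a homomorphism.\<close>

definition lift :: "'a \<Rightarrow> 'g" where
  "lift w = foldr (\<lambda>s x. n s \<cdot> x) (nf w) \<one>\<^bsub>G\<^esub>"

lemma lift_word: "ws \<in> lists S \<Longrightarrow> foldr (\<lambda>s x. n s \<cdot> x) ws \<one>\<^bsub>G\<^esub> \<in> carrier G"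
  by (induction ws) (auto simp: n_closed)

lemma lift_closed [simp]: "w \<in> carrier W \<Longrightarrow> lift w \<in> carrier G"
  unfolding lift_def using lift_word[of "nf w"] reduced_nf by simp

lemma lift_gen_mult: "s \<in> S \<Longrightarrow> w \<in> carrier W \<Longrightarrow> lift (s \<otimes> w) = n s \<cdot> lift w"
proof -
  assume s: "s \<in> S" and w: "w \<in> carrier W"
  show ?thesis
  proof (cases "nf w \<noteq> [] \<and> hd (nf w) = s")
    case True
    then obtain v where v: "nf w = s # v" by (cases "nf w") auto
    then have "v \<in> lists S" using reduced_nf[OF w] by (simp add: reduced_def)
    then show ?thesis using v s cancel_n[OF s lift_word] by (simp add: lift_def nf_mult[OF s w] push_def)
  next
    case False
    then show ?thesis by (auto simp: lift_def nf_mult[OF s w] push_def)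
  qed
qed

lemma lift_one [simp]: "lift \<one> = \<one>\<^bsub>G\<^esub>"
  using nf_word_prod[of "[]"] by (simp add: lift_def reduced_def)

lemma lift_word_prod_mult: "ws \<in> lists S \<Longrightarrow> w \<in> carrier W \<Longrightarrow>
    lift (word_prod W ws \<otimes> w) = lift (word_prod W ws) \<cdot> lift w"
proof (induction ws)
  case (Cons s ws)
  then have c: "s \<in> carrier W" "word_prod W ws \<in> carrier W" "s \<in> S" using S_carrier by auto
  then have "lift (word_prod W (s # ws) \<otimes> w) = n s \<cdot> lift (word_prod W ws \<otimes> w)"
    using Cons lift_gen_mult[of s "word_prod W ws \<otimes> w"] by (simp add: m_assoc)
  then show ?case using Cons c lift_gen_mult[of s "word_prod W ws"] by (simp add: G.m_assoc n_closed)
qed simp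

lemma lift_mult: "v \<in> carrier W \<Longrightarrow> w \<in> carrier W \<Longrightarrow> lift (v \<otimes> w) = lift v \<cdot> lift w"
  using lift_word_prod_mult[of "nf v" w] nf[of v] by simp

lemma lift_gen: "s \<in> S \<Longrightarrow> lift s = n s"
  using lift_gen_mult[of s \<one>] S_carrier n_closed by simp

definition root_gen :: "'a \<Rightarrow> 'a \<Rightarrow> 'g" where
  "root_gen v s = lift v \<cdot> u s \<cdot> inv\<^bsub>G\<^esub> (lift v)"

text \<open>The argument is a set, so the pair \<open>v\<close>, \<open>s\<close> is quantified; by
  \<open>root_inj\<close> it is unique, and the group has order two. Sets that are not roots are
  sent to the empty set.\<close>

definition U :: "'a set \<Rightarrow> 'g set" where
  "U \<alpha> = {x. \<exists>v\<in>carrier W. \<exists>s\<in>S. \<alpha> = root v s \<and> x \<in> {\<one>\<^bsub>G\<^esub>, root_gen v s}}"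

lemma U_root: "v \<in> carrier W \<Longrightarrow> s \<in> S \<Longrightarrow> U (root v s) = {\<one>\<^bsub>G\<^esub>, root_gen v s}"
  unfolding U_def using root_inj by fast

lemma root_gen_closed [simp]: "v \<in> carrier W \<Longrightarrow> s \<in> S \<Longrightarrow> root_gen v s \<in> carrier G"
  by (simp add: root_gen_def u_closed)

lemma root_gen_conj: "w \<in> carrier W \<Longrightarrow> v \<in> carrier W \<Longrightarrow> s \<in> S \<Longrightarrow>
    root_gen (w \<otimes> v) s = lift w \<cdot> root_gen v s \<cdot> inv\<^bsub>G\<^esub> (lift w)"
  by (simp add: root_gen_def lift_mult G.inv_mult_group G.m_assoc u_closed)

lemma root_gen_sq: "v \<in> carrier W \<Longrightarrow> s \<in> S \<Longrightarrow> root_gen v s \<cdot> root_gen v s = \<one>\<^bsub>G\<^esub>"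
proof -
  assume v: "v \<in> carrier W" and s: "s \<in> S"
  have "root_gen v s \<cdot> root_gen v s = lift v \<cdot> ((u s \<cdot> u s) \<cdot> inv\<^bsub>G\<^esub> (lift v))"
    using v s u_closed by (simp add: root_gen_def G.m_assoc G.cancel_left)
  then show ?thesis using v s u_sq by simp
qed

lemma root_gen_inv: "v \<in> carrier W \<Longrightarrow> s \<in> S \<Longrightarrow> inv\<^bsub>G\<^esub> (root_gen v s) = root_gen v s"
  using root_gen_sq by (intro G.inv_equality) auto

lemma root_gen_neq_one: "v \<in> carrier W \<Longrightarrow> s \<in> S \<Longrightarrow> root_gen v s \<noteq> \<one>\<^bsub>G\<^esub>"
proof
  assume v: "v \<in> carrier W" and s: "s \<in> S" and eq: "root_gen v s = \<one>\<^bsub>G\<^esub>"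
  have "u s = inv\<^bsub>G\<^esub> (lift v) \<cdot> root_gen v s \<cdot> lift v"
    using v s u_closed by (simp add: root_gen_def G.m_assoc G.cancel_left)
  then show False using eq v s u_nontrivial by simp
qed

lemma root_gen_root_elt: "reduced (z @ [s]) \<Longrightarrow> root_gen (word_prod W z) s = r (z @ [s])"
proof (induction z)
  case Nil
  then show ?case using u_closed by (auto simp: root_gen_def reduced_def)
next
  case (Cons t z)
  then have c: "reduced (z @ [s])" "t \<in> S" "s \<in> S" "z \<in> lists S"
    by (auto simp: reduced_def distinct_adj_Cons)
  have "inv\<^bsub>G\<^esub> (n t) = n t" using c n_sq n_closed by (intro G.inv_equality) auto
  then have "root_gen (word_prod W (t # z)) s = n t \<cdot> r (z @ [s]) \<cdot> n t"
    using c Cons.IH root_gen_conj[of t "word_prod W z" s] S_carrier lift_gen by simp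
  then show ?case by (cases z) auto
qed

lemma U_subset: "\<alpha> \<in> roots W S \<Longrightarrow> U \<alpha> \<subseteq> carrier G"
  by (auto simp: roots_root U_root)

lemma U_pos:
  assumes "reduced g" "g \<noteq> []" shows "U (pos g) = {\<one>\<^bsub>G\<^esub>, r g}"
proof -
  have g: "reduced (butlast g @ [last g])" using assms by simp
  then have "butlast g \<in> lists S" "last g \<in> S" by (auto simp: reduced_def)
  then show ?thesis using U_root[of "word_prod W (butlast g)" "last g"] root_pos[OF g] root_gen_root_elt[OF g] assms
    by simp
qed

lemma valid_reduced: "valid g \<longleftrightarrow> reduced g \<and> g \<noteq> []"
  by (auto simp: valid_def reduced_def)

section \<open>Prenilpotent pairs and root intervals\<close>

lemma l_coset_cancel: "w \<in> carrier W \<Longrightarrow> A \<subseteq> carrier W \<Longrightarrow> inv w <# (w <# A) = A"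
  by (simp add: lcos_m_assoc lcos_mult_one)

lemma pos_root_ex:
  assumes "valid g"
  obtains v s where "v \<in> carrier W" "s \<in> S" "pos g = root v s" "r g = root_gen v s"
proof -
  have g: "reduced (butlast g @ [last g])" using assms by (simp add: valid_reduced)
  then have "butlast g \<in> lists S" "last g \<in> S" by (auto simp: reduced_def)
  then show thesis using that[of "word_prod W (butlast g)" "last g"] root_pos[OF g] root_gen_root_elt[OF g] assms
    by (simp add: valid_reduced)
qed

lemma U_translate_pos:
  assumes "valid g" "w \<in> carrier W"
  shows "U (w <# pos g) = {\<one>\<^bsub>G\<^esub>, lift w \<cdot> r g \<cdot> inv\<^bsub>G\<^esub> (lift w)}" "w <# pos g \<in> roots W S"
proof -
  obtain v s where v: "v \<in> carrier W" "s \<in> S" "pos g = root v s" "r g = root_gen v s"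
    using pos_root_ex[OF assms(1)] .
  then show "U (w <# pos g) = {\<one>\<^bsub>G\<^esub>, lift w \<cdot> r g \<cdot> inv\<^bsub>G\<^esub> (lift w)}"
    using assms by (simp add: root_mult U_root root_gen_conj)
  show "w <# pos g \<in> roots W S" using v assms(2) root_mult[of v w s] unfolding roots_root by auto
qed

lemma pos_carrier: "pos g \<subseteq> carrier W"
  by (auto simp: pos_def)

lemma interval_pos:
  assumes w: "w \<in> carrier W" and g: "valid g" and p: "prefix p h" "prefix h g" "p \<noteq> h" "h \<noteq> g" "p \<noteq> []"
  shows "w <# pos h \<in> open_root_interval W S (w <# pos p) (w <# pos g)"
    and "w <# pos h \<in> open_root_interval W S (w <# pos g) (w <# pos p)"
proof -
  have "h \<noteq> []" using p(1,5) by auto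
  then have v: "valid h" "valid p" using valid_prefix[OF g] p by (auto intro: prefix_order.trans)
  have sub: "pos p \<subseteq> pos h" "pos h \<subseteq> pos g" using p by (auto simp: pos_def intro: prefix_order.trans)
  then have sub': "w <# pos p \<subseteq> w <# pos h" "w <# pos h \<subseteq> w <# pos g" by (auto simp: l_coset_def)
  have ne: "w <# pos h \<noteq> w <# pos p" "w <# pos h \<noteq> w <# pos g"
    using l_coset_cancel[OF w pos_carrier] pos_inj v g p by (metis valid_reduced)+
  show "w <# pos h \<in> open_root_interval W S (w <# pos p) (w <# pos g)"
    "w <# pos h \<in> open_root_interval W S (w <# pos g) (w <# pos p)"
    using sub' ne U_translate_pos(2)[OF v(1) w]
    by (auto simp: open_root_interval_def closed_root_interval_def neg_root_def)
qed

lemma root_translate: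
  assumes "w \<in> carrier W" "v \<in> carrier W" "s \<in> S" "x \<in> carrier W"
  shows "x \<in> root (w \<otimes> v) s \<longleftrightarrow> inv w \<otimes> x \<in> root v s"
  using assms by (simp add: root_iff inv_mult_group m_assoc)

text \<open>Translation by the inverse of \<open>v\<close> makes the first root simple. An element
  in both roots and one in neither leave only nested positions, described by a path whose first edge
  bounds the smaller root and whose last edge bounds the larger one.\<close>

lemma prenilpotent_cases:
  assumes v: "v \<in> carrier W" "s \<in> S" and v': "v' \<in> carrier W" "s' \<in> S"
    and ne: "root v s \<noteq> root v' s'" and pre: "prenilpotent W (root v s) (root v' s')"
  obtains w t y where "w \<in> carrier W" "valid (t # y)" "y \<noteq> []" "root v s = w <# pos [t]" "root v' s' = w <# pos (t # y)"
  | w t y where "w \<in> carrier W" "valid (t # y)" "y \<noteq> []" "root v' s' = w <# pos [t]" "root v s = w <# pos (t # y)"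
proof -
  define w where "w = inv v \<otimes> v'"
  have w: "w \<in> carrier W" "v' = v \<otimes> w" using v v' by (simp_all add: w_def flip: m_assoc)
  have root1: "root \<one> t = pos [t]" if "t \<in> S" for t
    using root_pos[of "[]" t] that by (simp add: reduced_def)
  have tr: "x \<in> root v s \<longleftrightarrow> inv v \<otimes> x \<in> pos [s]" "x \<in> root v' s' \<longleftrightarrow> inv v \<otimes> x \<in> root w s'"
    if "x \<in> carrier W" for x
    using root_translate[of v \<one> s x] root_translate[of v w s' x] root1 v v' w that by simp_all
  obtain x1 where x1: "x1 \<in> carrier W" "inv v \<otimes> x1 \<in> pos [s]" "inv v \<otimes> x1 \<in> root w s'"
    using pre root_subset[OF v] tr unfolding prenilpotent_def by blast
  obtain x2 where x2: "x2 \<in> carrier W" "inv v \<otimes> x2 \<notin> pos [s]" "inv v \<otimes> x2 \<notin> root w s'"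
    using pre tr unfolding prenilpotent_def neg_root_def by blast
  from w(1) v'(2) show thesis
  proof (cases rule: root_cases)
    case (1 z)
    let ?h = "z @ [s']"
    \<comment> \<open>The element outside both roots has both words as prefixes of its normal form,
      so the two words are comparable.\<close>
    have "prefix [s] (nf (inv v \<otimes> x2))" "prefix ?h (nf (inv v \<otimes> x2))"
      using x2 1 v by (auto simp: pos_def)
    then have "prefix [s] ?h \<or> prefix ?h [s]" by (rule prefix_same_cases)
    then have "prefix [s] ?h" by (auto simp: prefix_Cons)
    then obtain y where y: "?h = s # y" by (auto simp: prefix_def)
    have eq: "root v s = v <# pos [s]" "root v' s' = v <# pos (s # y)"
      using root_mult[of \<one> v s] root_mult[of w v s'] v v' w root1 1 y by simp_all
    have "y \<noteq> []" using eq ne by auto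
    moreover have "valid (s # y)" using 1 y by (simp add: valid_reduced)
    ultimately show ?thesis using that(1) eq v by blast
  next
    case (2 z)
    let ?h = "z @ [s']"
    \<comment> \<open>The common element lies beyond the path \<open>?h\<close> but not beyond the
      edge \<open>s\<close>, so \<open>s # ?h\<close> is reduced. Read backwards from
      \<open>v'\<close>, this path shows the pair nested with the roles exchanged.\<close>
    have "\<not> prefix [s] (nf (inv v \<otimes> x1))" "prefix ?h (nf (inv v \<otimes> x1))"
      using x1 2 v by (auto simp: pos_def neg_def)
    then have "\<not> prefix [s] ?h" using prefix_order.trans by blast
    then have hd: "hd ?h \<noteq> s" by (cases z) (auto simp: prefix_single)
    then have "reduced (s # ?h)" using 2 v by (simp add: reduced_def distinct_adj_Cons)
    then have "reduced (rev (s # ?h))" by (auto simp: reduced_def simp del: rev.simps)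
    then have red: "reduced (rev ?h @ [s])" by simp
    have rh: "rev ?h \<in> lists S" "?h \<in> lists S" using 2 red by (auto simp: reduced_def)
    have "v = v' \<otimes> inv w" using v v' by (simp add: w_def inv_mult_group cancel_left)
    then have v_eq: "v = v' \<otimes> word_prod W (rev ?h)" using 2 inv_word_prod[OF rh(2)] by simp
    have "root v s = v' <# root (word_prod W (rev ?h)) s"
      using root_mult[OF word_prod_closed[OF rh(1)] v'(1) v(2)] v_eq by simp
    then have "root v s = v' <# pos (s' # (rev z @ [s]))" using root_pos[OF red] by simp
    moreover have "root v' s' = v' <# pos [s']" using root_mult[of \<one> v' s'] v' root1 by simp
    moreover have "valid (s' # (rev z @ [s]))" using red by (simp add: valid_reduced)
    ultimately show ?thesis using that(2) v' by blast
  qed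
qed

text \<open>Conjugation by \<open>lift w\<close> reduces the commutator to a relation along a path
  from \<open>1\<close> with conjugating word of length one; it yields \<open>1\<close> or the
  generator of a root strictly in between.\<close>

lemma comm_pos:
  assumes w: "w \<in> carrier W" and g: "valid (t # y)" and y: "y \<noteq> []"
    and x: "x \<in> U (w <# pos [t])" "x' \<in> U (w <# pos (t # y))"
    and I: "I = open_root_interval W S (w <# pos [t]) (w <# pos (t # y)) \<or>
      I = open_root_interval W S (w <# pos (t # y)) (w <# pos [t])"
  shows "G.comm x x' \<in> generate G (\<Union>\<gamma>\<in>I. U \<gamma>) \<and> G.comm x' x \<in> generate G (\<Union>\<gamma>\<in>I. U \<gamma>)"
proof -
  have vt: "valid [t]" using valid_prefix[OF g, of "[t]"] by simp
  note U1 = U_translate_pos[OF vt w] and U2 = U_translate_pos[OF g w]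
  have cl: "r [t] \<in> carrier G" "r (t # y) \<in> carrier G" using vt g root_closed valid_set by blast+
  have xc: "x \<in> carrier G" "x' \<in> carrier G" using x U_subset U1(2) U2(2) by auto
  have roots_I: "\<gamma> \<in> roots W S" if "\<gamma> \<in> I" for \<gamma>
    using that I by (auto simp: open_root_interval_def closed_root_interval_def)
  have sg: "subgroup (generate G (\<Union>\<gamma>\<in>I. U \<gamma>)) G"
    using U_subset roots_I by (intro G.generate_is_subgroup) blast
  have "G.comm x x' \<in> generate G (\<Union>\<gamma>\<in>I. U \<gamma>)"
  proof (cases "x = \<one>\<^bsub>G\<^esub> \<or> x' = \<one>\<^bsub>G\<^esub>")
    case True
    then show ?thesis using xc generate.one[of G] by auto
  next
    case False
    then have "G.comm x x' = lift w \<cdot> G.comm (r [t]) (r (t # y)) \<cdot> inv\<^bsub>G\<^esub> (lift w)"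
      using x U1 U2 cl w by (simp add: G.conj_comm)
    moreover have "[] @ [t] @ y = t # y" by simp
    ultimately consider "G.comm x x' = \<one>\<^bsub>G\<^esub>"
      | y' where "y' \<in> set (conj_word t y)" "y' \<noteq> y" "G.comm x x' = lift w \<cdot> r (t # y') \<cdot> inv\<^bsub>G\<^esub> (lift w)"
    proof (cases rule: conj_word_cases[of t y])
      case 1
      then show ?thesis using that(1) comm_conj_word(1)[of "[]" t y] g y w
        \<open>G.comm x x' = _\<close> by simp
    next
      case (2 k i)
      then show ?thesis using that(2)[of "block k (unset_bit k i)"] comm_conj_word(2)[of "[]" t y "block k (unset_bit k i)"] g y w
        \<open>G.comm x x' = _\<close> block_inj[of k "unset_bit k i" k i] unset_bit_less[of i k] by auto
    qed
    then show ?thesis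
    proof cases
      case 1
      then show ?thesis by (simp add: generate.one)
    next
      case (2 y')
      have y': "y' \<noteq> []" "prefix y' y" using conj_word_nonempty conj_word_prefix 2(1) y by blast+
      then have h: "valid (t # y')" using valid_prefix[OF g, of "t # y'"] by simp
      have "w <# pos (t # y') \<in> I"
        using interval_pos[OF w g, of "[t]" "t # y'"] y' 2(2) I by auto
      moreover have "G.comm x x' \<in> U (w <# pos (t # y'))" using U_translate_pos(1)[OF h w] 2(3) by simp
      ultimately show ?thesis by (auto intro: generate.incl)
    qed
  qed
  then show ?thesis using G.inv_comm[OF xc] subgroup.m_inv_closed[OF sg] by metis
qed

lemma RGD: "RGD_system W S G U"
proof (intro RGD_system.intro RGD_system_axioms.intro)
  show "coxeter_system W S" "group G" by unfold_locales
next
  fix \<alpha> assume "\<alpha> \<in> roots W S"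
  then obtain v s where v: "v \<in> carrier W" "s \<in> S" "\<alpha> = root v s" by (auto simp: roots_root)
  show "subgroup (U \<alpha>) G"
    by (rule subgroup.intro) (use v in \<open>auto simp: U_root root_gen_sq root_gen_inv\<close>)
  show "U \<alpha> \<noteq> {\<one>\<^bsub>G\<^esub>}" using v root_gen_neq_one by (auto simp: U_root)
next
  fix \<alpha> \<beta> assume ab: "\<alpha> \<in> roots W S" "\<beta> \<in> roots W S" "\<alpha> \<noteq> \<beta>" "prenilpotent W \<alpha> \<beta>"
  let ?J = "generate G (\<Union>\<gamma>\<in>open_root_interval W S \<alpha> \<beta>. U \<gamma>)"
  obtain v s v' s' where v: "v \<in> carrier W" "s \<in> S" "\<alpha> = root v s" "v' \<in> carrier W" "s' \<in> S" "\<beta> = root v' s'"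
    using ab by (auto simp: roots_root)
  have "G.comm x x' \<in> ?J" if x: "x \<in> U \<alpha>" "x' \<in> U \<beta>" for x x'
    by (rule prenilpotent_cases[OF v(1,2,4,5)])
      (use ab v x comm_pos[of _ _ _ _ _ "open_root_interval W S \<alpha> \<beta>"] in auto)
  then have "(\<Union>x\<in>U \<alpha>. \<Union>x'\<in>U \<beta>. {x \<cdot> x' \<cdot> inv\<^bsub>G\<^esub> x \<cdot> inv\<^bsub>G\<^esub> x'}) \<subseteq> ?J"
    by (auto simp: G.comm_def)
  moreover have "subgroup ?J G"
    by (intro G.generate_is_subgroup)
      (use U_subset in \<open>auto simp: open_root_interval_def closed_root_interval_def\<close>)
  ultimately show "commutator_subgroup G (U \<alpha>) (U \<beta>) \<subseteq> ?J"
    unfolding commutator_subgroup_def by (rule G.generate_subgroup_incl)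
next
  fix s x assume s: "s \<in> S" and x: "x \<in> U (simple_root W S s) - {\<one>\<^bsub>G\<^esub>}"
  have sr: "simple_root W S s = root \<one> s"
    unfolding root_def by (rule lcos_mult_one[symmetric]) (auto simp: simple_root_def)
  then have xs: "x = u s" using x s u_closed by (auto simp: U_root root_gen_def)
  have "neg_root W (simple_root W S s) = root s s" using neg_root_root[of \<one> s] s S_carrier sr by simp
  moreover have "inv\<^bsub>G\<^esub> (n s) = n s" using s n_sq n_closed by (intro G.inv_equality) auto
  ultimately have neg: "n s \<cdot> u s \<cdot> n s \<in> U (neg_root W (simple_root W S s))"
    using s S_carrier by (simp add: U_root root_gen_def lift_gen)
  have "n s <#\<^bsub>G\<^esub> U \<beta> #>\<^bsub>G\<^esub> inv\<^bsub>G\<^esub> (n s) = U (s <# \<beta>)" if b: "\<beta> \<in> roots W S" for \<beta>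
  proof -
    obtain v t where v: "v \<in> carrier W" "t \<in> S" "\<beta> = root v t" using b by (auto simp: roots_root)
    then have "U (s <# \<beta>) = {\<one>\<^bsub>G\<^esub>, n s \<cdot> root_gen v t \<cdot> inv\<^bsub>G\<^esub> (n s)}"
      using s S_carrier root_gen_conj[of s v t] by (simp add: root_mult U_root lift_gen)
    then show ?thesis using v s n_closed by (auto simp: U_root l_coset_def r_coset_def)
  qed
  \<comment> \<open>Both witnesses are the generator of the negative root group; by
    \<open>braid\<close> the product is \<open>n s\<close>, which permutes the root groups as
    \<open>s\<close> does.\<close>
  then show "\<exists>u'\<in>U (neg_root W (simple_root W S s)). \<exists>u''\<in>U (neg_root W (simple_root W S s)).
      \<forall>\<beta>\<in>roots W S. (u' \<cdot> x \<cdot> u'') <#\<^bsub>G\<^esub> U \<beta> #>\<^bsub>G\<^esub> inv\<^bsub>G\<^esub> (u' \<cdot> x \<cdot> u'') = U (s <# \<beta>)"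
    using neg braid[OF s] xs by (intro bexI[OF _ neg]) simp
next
  fix s assume s: "s \<in> S"
  have sr: "simple_root W S s = root \<one> s"
    unfolding root_def by (rule lcos_mult_one[symmetric]) (auto simp: simple_root_def)
  have "neg_root W (simple_root W S s) = root s s" using neg_root_root[of \<one> s] s S_carrier sr by simp
  moreover have "inv\<^bsub>G\<^esub> (n s) = n s" using s n_sq n_closed by (intro G.inv_equality) auto
  ultimately have neg: "n s \<cdot> u s \<cdot> n s \<in> U (neg_root W (simple_root W S s))"
    using s S_carrier by (simp add: U_root root_gen_def lift_gen)
  let ?P = "generate G (r ` {g. valid g})"
  have "U \<alpha> \<subseteq> ?P" if pos: "\<alpha> \<in> pos_roots W S" for \<alpha>
  proof -
    obtain g where g: "valid g" "U \<alpha> = {\<one>\<^bsub>G\<^esub>, r g}"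
      using pos U_pos by (auto simp: pos_root_iff valid_reduced)
    then have "r g \<in> ?P" by (intro generate.incl) auto
    then show ?thesis using g generate.one[of G] by simp
  qed
  then have "(\<Union>\<alpha>\<in>pos_roots W S. U \<alpha>) \<subseteq> ?P" by blast
  moreover have "subgroup ?P G" using root_closed valid_set by (intro G.generate_is_subgroup) auto
  ultimately have "pos_subgroup W S G U \<subseteq> ?P"
    unfolding pos_subgroup_def by (rule G.generate_subgroup_incl)
  then show "\<not> U (neg_root W (simple_root W S s)) \<subseteq> pos_subgroup W S G U"
    using neg neg_not_pos[OF s] by blast
next
  let ?A = "generate G (\<Union>\<alpha>\<in>roots W S. U \<alpha>)"
  have sub: "(\<Union>\<alpha>\<in>roots W S. U \<alpha>) \<subseteq> carrier G" using U_subset by blast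
  then interpret A: subgroup ?A G by (rule G.generate_is_subgroup)
  \<comment> \<open>By \<open>braid\<close>, \<open>n s\<close> is a product of elements of the two
    root groups at the edge between \<open>1\<close> and \<open>s\<close>. So the root groups
    generate \<open>G\<close>, and the identity can serve as the factor from the normalizer.\<close>
  have "u s \<in> ?A \<and> n s \<in> ?A" if s: "s \<in> S" for s
  proof -
    have "root \<one> s \<in> roots W S" "root s s \<in> roots W S" using s S_carrier by (auto simp: roots_root)
    moreover have "inv\<^bsub>G\<^esub> (n s) = n s" using s n_sq n_closed by (intro G.inv_equality) auto
    then have "u s \<in> U (root \<one> s)" "n s \<cdot> u s \<cdot> n s \<in> U (root s s)"
      using s S_carrier u_closed by (simp_all add: U_root root_gen_def lift_gen)
    ultimately have "u s \<in> ?A" "n s \<cdot> u s \<cdot> n s \<in> ?A" by (blast intro: generate.incl)+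
    then show ?thesis using braid[OF s] A.m_closed by metis
  qed
  then have "generate G (n ` S \<union> u ` S) \<subseteq> ?A" by (intro G.generate_subgroup_incl A.subgroup_axioms) auto
  then have A: "?A = carrier G" using generated A.subset by blast
  have "\<one>\<^bsub>G\<^esub> \<in> root_normalizer W S G U"
  proof -
    have "\<one>\<^bsub>G\<^esub> <#\<^bsub>G\<^esub> U \<alpha> #>\<^bsub>G\<^esub> inv\<^bsub>G\<^esub> \<one>\<^bsub>G\<^esub> = U \<alpha>" if "\<alpha> \<in> roots W S" for \<alpha>
      using U_subset[OF that] by (simp add: G.lcos_mult_one G.coset_mult_one)
    then show ?thesis by (auto simp: root_normalizer_def normalizer_def stabilizer_def U_subset)
  qed
  then show "carrier G = root_normalizer W S G U <#>\<^bsub>G\<^esub> ?A"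
    unfolding A by (auto simp: set_mult_def root_normalizer_def intro!: bexI[of _ "\<one>\<^bsub>G\<^esub>"])
qed

section \<open>The nilpotency classes of the groups \<open>U_w\<close>\<close>

lemma reduced_prefix: "reduced z \<Longrightarrow> prefix g z \<Longrightarrow> reduced g"
  by (auto simp: reduced_def prefix_def)

lemma segments_carrier:
  assumes "reduced z" shows "r ` segments z \<subseteq> carrier G"
proof
  fix x assume "x \<in> r ` segments z"
  then obtain g where g: "x = r g" "prefix g z" by (auto simp: segments_def)
  then have "set g \<subseteq> S" using reduced_prefix[OF assms] by (auto simp: reduced_def)
  then show "x \<in> carrier G" using g root_closed by simp
qed

text \<open>An element \<open>w\<close> lies outside \<open>pos g\<close> exactly if
  \<open>g\<close> is a prefix of its normal form, so the generators are those along the path from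
  \<open>1\<close> to \<open>w\<close>.\<close>

lemma U_sub_chain:
  assumes "w \<in> carrier W" shows "U_sub W S G U w = chain_group (nf w)"
proof -
  have red: "reduced (nf w)" using assms by (rule reduced_nf)
  have "{\<alpha> \<in> pos_roots W S. w \<notin> \<alpha>} = pos ` segments (nf w)"
  proof -
    show ?thesis using assms reduced_prefix[OF red] by (auto simp: pos_root_iff pos_def segments_def)
  qed
  then have eq: "(\<Union>\<alpha>\<in>{\<alpha> \<in> pos_roots W S. w \<notin> \<alpha>}. U \<alpha>) = (\<Union>g\<in>segments (nf w). {\<one>\<^bsub>G\<^esub>, r g})"
  proof -
    have "U (pos g) = {\<one>\<^bsub>G\<^esub>, r g}" if "g \<in> segments (nf w)" for g
      using that by (intro U_pos reduced_prefix[OF red]) (auto simp: segments_def)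
    then show ?thesis using \<open>{\<alpha> \<in> pos_roots W S. w \<notin> \<alpha>} = pos ` segments (nf w)\<close> by simp
  qed
  have sub: "r ` segments (nf w) \<subseteq> carrier G"
    by (rule segments_carrier[OF red])
  show ?thesis unfolding U_sub_def eq
  proof
    show "generate G (\<Union>g\<in>segments (nf w). {\<one>\<^bsub>G\<^esub>, r g}) \<subseteq> chain_group (nf w)"
      by (intro G.generate_subgroup_incl G.generate_is_subgroup sub)
        (auto intro: generate.one generate.incl)
    show "chain_group (nf w) \<subseteq> generate G (\<Union>g\<in>segments (nf w). {\<one>\<^bsub>G\<^esub>, r g})"
      by (intro G.mono_generate) auto
  qed
qed

lemma chain_nil: "chain_group [] = {\<one>\<^bsub>G\<^esub>}"
  by (simp add: segments_def G.generate_empty)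

lemma lower_central_U_sub:
  assumes w: "w \<in> carrier W" and K: "\<And>g. weight g \<le> K \<or> \<not> prefix g (nf w)"
  shows "lower_central (G\<lparr>carrier := U_sub W S G U w\<rparr>) (Suc K) = {\<one>\<^bsub>G\<^esub>}"
proof (cases "nf w = []")
  case False
  then have "valid (nf w)" using reduced_nf[OF w] by (simp add: valid_reduced)
  then show ?thesis using K chain_lower_central[of "nf w" K] by (auto simp: U_sub_chain[OF w] segments_def)
next
  case True
  have sg: "subgroup {\<one>\<^bsub>G\<^esub>} G" by (rule G.triv_subgroup)
  have "lower_central (G\<lparr>carrier := {\<one>\<^bsub>G\<^esub>}\<rparr>) (Suc K) \<subseteq> {\<one>\<^bsub>G\<^esub>}" by (rule G.lower_central_subset[OF sg])
  moreover have "\<one>\<^bsub>G\<^esub> \<in> lower_central (G\<lparr>carrier := {\<one>\<^bsub>G\<^esub>}\<rparr>) (Suc K)"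
    using generate.one[of "G\<lparr>carrier := {\<one>\<^bsub>G\<^esub>}\<rparr>"] by (simp add: commutator_subgroup_def)
  ultimately show ?thesis using True by (auto simp: U_sub_chain[OF w] chain_nil simp del: lower_central.simps)
qed

text \<open>A word has finitely many prefixes, so the weights along a path are bounded even if
  \<open>L\<close> is infinite.\<close>

lemma nilpotent: "nilpotent_RGD W S G U"
  unfolding nilpotent_RGD_def nilpotent_group_def
proof (intro ballI conjI)
  fix w assume w: "w \<in> carrier W"
  have "r ` segments (nf w) \<subseteq> carrier G" by (rule segments_carrier[OF reduced_nf[OF w]])
  then have "subgroup (U_sub W S G U w) G" unfolding U_sub_chain[OF w] by (rule G.generate_is_subgroup)
  then show "group (G\<lparr>carrier := U_sub W S G U w\<rparr>)" by (rule G.subgroup_imp_group)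
  have fin: "finite {g. prefix g (nf w)}" using set_prefixes_eq[of "nf w"] finite_set by metis
  have "weight g \<le> Max (weight ` {g. prefix g (nf w)}) \<or> \<not> prefix g (nf w)" for g
    using fin by (cases "prefix g (nf w)") auto
  from lower_central_U_sub[OF w this]
  show "\<exists>n. lower_central (G\<lparr>carrier := U_sub W S G U w\<rparr>) n = {\<one>\<^bsub>G\<lparr>carrier := U_sub W S G U w\<rparr>\<^esub>}"
    by (intro exI) (simp del: lower_central.simps)
qed

lemma ndeg_le:
  assumes "finite L" shows "ndeg W S G U \<le> enat (Suc (card L))"
  unfolding ndeg_def
proof (rule SUP_least)
  fix w assume w: "w \<in> carrier W"
  have "weight g \<le> card L" for g unfolding weight_def by (intro card_mono assms) auto
  then have "lower_central (G\<lparr>carrier := U_sub W S G U w\<rparr>) (Suc (card L)) = {\<one>\<^bsub>G\<^esub>}"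
    using w by (intro lower_central_U_sub) auto
  then show "nilpotency_class (G\<lparr>carrier := U_sub W S G U w\<rparr>) \<le> enat (Suc (card L))"
    unfolding nilpotency_class_def by (intro Inf_lower) (auto simp del: lower_central.simps)
qed

text \<open>For the endpoint of the path \<open>long_chain N (mask N)\<close> the terms with indices
  \<open>0\<close> to \<open>N\<close> are nontrivial, so a trivial term has index at least
  \<open>Suc N\<close>.\<close>

lemma ndeg_ge:
  assumes "{..<N} \<subseteq> L" shows "enat (Suc N) \<le> ndeg W S G U"
proof -
  let ?z = "long_chain N (mask N)"
  let ?w = "word_prod W ?z"
  have z: "reduced ?z" using long_chain_valid[of N "mask N"] by (simp add: valid_reduced)
  then have w: "?w \<in> carrier W" "nf ?w = ?z" by auto
  have "enat (Suc N) \<le> nilpotency_class (G\<lparr>carrier := U_sub W S G U ?w\<rparr>)"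
    unfolding nilpotency_class_def U_sub_chain[OF w(1)] w(2)
  proof (rule Inf_greatest)
    fix x assume "x \<in> {enat n |n. lower_central (G\<lparr>carrier := chain_group ?z\<rparr>) n = {\<one>\<^bsub>G\<lparr>carrier := chain_group ?z\<rparr>\<^esub>}}"
    then obtain j where j: "x = enat j" "lower_central (G\<lparr>carrier := chain_group ?z\<rparr>) j = {\<one>\<^bsub>G\<^esub>}" by auto
    then have "\<not> j \<le> N" using long_chain_lower_central[OF assms, of j] by blast
    then show "enat (Suc N) \<le> x" using j by simp
  qed
  also have "\<dots> \<le> ndeg W S G U" unfolding ndeg_def using w(1) by (intro SUP_upper)
  finally show ?thesis .
qed

end

text \<open>The two bounds meet if \<open>L\<close> is a finite initial segment and force the
  supremum to be infinite if \<open>L\<close> is everything. As \<open>S\<close> is finite, hence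
  countable, \<open>G\<close> can live on the natural numbers.\<close>

lemma universal_RGD_exists:
  fixes W :: "'w monoid" and S :: "'w set" and L :: "nat set"
  assumes "universal_coxeter_system W S" "finite S" "card S \<ge> 3"
  obtains G :: "nat monoid" and U where "RGD_system W S G U" "nilpotent_RGD W S G U"
    "finite L \<Longrightarrow> ndeg W S G U \<le> enat (Suc (card L))"
    "\<And>N. {..<N} \<subseteq> L \<Longrightarrow> enat (Suc N) \<le> ndeg W S G U"
proof -
  obtain Q where "Q \<subseteq> S" "card Q = 3" using assms by (metis obtain_subset_with_card_n)
  then obtain a b c where abc: "a \<in> S" "b \<in> S" "c \<in> S" "a \<noteq> b" "a \<noteq> c" "b \<noteq> c"
    by (auto simp: card_3_iff)
  interpret blueprint S a b c L by unfold_locales (use abc in auto)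
  obtain G :: "nat monoid" and n u where "blueprint_group S a b c L G n u"
    using blueprint_group_exists assms(2) countable_finite by metis
  then interpret universal_blueprint W S a b c L G n u
    using assms(1) by (simp add: universal_blueprint_def)
  show thesis using that RGD nilpotent ndeg_le ndeg_ge by blast
qed

theorem corollary3:
  fixes W :: "'w monoid" and S :: "'w set" and m :: nat
  assumes "universal_coxeter_system W S"
    and "finite S" and "card S = m" and "m \<ge> 3"
  shows "(\<forall>n::nat. n \<ge> 1 \<longrightarrow>
           (\<exists>(G :: nat monoid) (U :: 'w set \<Rightarrow> nat set).
              RGD_system W S G U \<and> nilpotent_RGD W S G U \<and> ndeg W S G U = enat n))
       \<and> (\<exists>(G :: nat monoid) (U :: 'w set \<Rightarrow> nat set).
              RGD_system W S G U \<and> nilpotent_RGD W S G U \<and> ndeg W S G U = \<infinity>)"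
proof (intro conjI allI impI)
  have S: "card S \<ge> 3" using assms by simp
  fix n :: nat assume "n \<ge> 1"
  then have n: "Suc (n - 1) = n" by simp
  \<comment> \<open>With \<open>L = {..<n - 1}\<close> both bounds are \<open>Suc (n - 1)\<close>,
    which is \<open>n\<close> because \<open>n \<ge> 1\<close>.\<close>
  obtain G :: "nat monoid" and U where "RGD_system W S G U" "nilpotent_RGD W S G U"
    "ndeg W S G U \<le> enat n" "enat n \<le> ndeg W S G U"
    using universal_RGD_exists[OF assms(1,2) S, of "{..<n - 1}"] n by (metis card_lessThan finite_lessThan order_refl)
  then show "\<exists>(G :: nat monoid) U. RGD_system W S G U \<and> nilpotent_RGD W S G U \<and> ndeg W S G U = enat n"
    by (meson antisym)
next
  have S: "card S \<ge> 3" using assms by simp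
  obtain G :: "nat monoid" and U where G: "RGD_system W S G U" "nilpotent_RGD W S G U"
    "\<And>N. enat (Suc N) \<le> ndeg W S G U"
    using universal_RGD_exists[OF assms(1,2) S, of UNIV] by (metis subset_UNIV)
  have "ndeg W S G U = \<infinity>"
  proof (cases "ndeg W S G U")
    case (enat k)
    then show ?thesis using G(3)[of k] by simp
  qed
  then show "\<exists>(G :: nat monoid) U. RGD_system W S G U \<and> nilpotent_RGD W S G U \<and> ndeg W S G U = \<infinity>"
    using G by blast
qed

end
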